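(* Let $\mathcal A$ be a C*-subalgebra of $\mathrm{Mat}(n,\mathbb C)$ with state space $\mathcal S$. If $\dim_{\mathbb C}(\mathcal A)>1$, then $C^{\mathrm I}\subsetneq C^{\mathrm{rI}}$, $\mathcal T^{\mathrm I}\supsetneq\mathcal T^{\mathrm{rI}}$, and $\mathcal S$ is not $\mathcal T^{\mathrm I}$ compact. Furthermore, the following assertions are equivalent: 1. $\mathcal A$ is commutative, 2. $\mathcal T^{\mathrm I}$ is second countable, 3. $\mathcal T^{\mathrm{rI}}$ is second countable, 4. $C^{\mathrm{rI}}=C^{\|\cdot\|}$, 5. $\mathcal T^{\mathrm{rI}}=\mathcal T^{\|\cdot\|}$, 6. $\mathcal S$ is $\mathcal T^{\mathrm{rI}}$ compact.
   Context: A C*-subalgebra $\mathcal A$ of $\mathrm{Mat}(n,\mathbb C)$ is a complex subalgebra closed under conjugate transpose; its identity need not be $\mathbb 1_n$. State space: $\mathcal S=\{\rho\in\mathcal A\mid\rho\succeq0,\ \mathrm{tr}(\rho)=1\}$. Relative entropy: $S(\rho,\sigma)=\mathrm{tr}\,\rho(\log\rho-\log\sigma)$ if $\mathrm{Im}(\rho)\subset\mathrm{Im}(\sigma)$ (logarithms taken on the respective images and extended by $0$ on the kernels), otherwise $S(\rho,\sigma)=+\infty$. Put $S^{\mathrm I}(\rho,\sigma):=S(\sigma,\rho)$ and $S^{\mathrm{rI}}(\rho,\sigma):=S(\rho,\sigma)$. For $\omega\in\{\mathrm I,\mathrm{rI}\}$, $C^\omega\subset\mathcal S^{\mathbb N}\times\mathcal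 S$ is the set of pairs $((\rho_i)_{i\in\mathbb N},\rho)$ with $\lim_{i\to\infty}S^\omega(\rho,\rho_i)=0$, and $\mathcal T^\omega$ is the topology on $\mathcal S$ consisting of all $U\subset\mathcal S$ such that $\rho\in U$ and $((\rho_i),\rho)\in C^\omega$ imply $\rho_i\in U$ for all large $i$. $C^{\|\cdot\|}$ is the set of pairs $((\rho_i),\rho)$ such that $\rho_i\to\rho$ in norm, and $\mathcal T^{\|\cdot\|}$ is the norm topology on $\mathcal S$. *)

theory Defs
  imports "HOL-Analysis.Analysis"
begin

section \<open>Complex matrices\<close>

definition cmat_scale :: "complex \<Rightarrow> complex^'n^'n \<Rightarrow> complex^'n^'n" where
  "cmat_scale c a = (\<chi> i j. c * a $ i $ j)"

text \<open>The library operator \<open>*s\<close> would take row vectors as scalars here, so the complex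
  vector space of matrices is set up explicitly; this provides \<open>cmat.subspace\<close> and the complex
  dimension \<open>cmat.dim\<close>.\<close>

interpretation cmat: vector_space "cmat_scale :: complex \<Rightarrow> complex^'n^'n \<Rightarrow> complex^'n^'n"
  by unfold_locales (simp_all add: cmat_scale_def vec_eq_iff algebra_simps)

definition conj_transpose :: "complex^'n^'m \<Rightarrow> complex^'m^'n" where
  "conj_transpose a = (\<chi> i j. cnj (a $ j $ i))"

definition positive_semidefinite :: "complex^'n^'n \<Rightarrow> bool" where
  "positive_semidefinite a \<longleftrightarrow>
     conj_transpose a = a \<and> (\<forall>x. 0 \<le> Re (\<Sum>i\<in>UNIV. cnj (x $ i) * (a *v x) $ i))"

definition mat_image :: "complex^'n^'n \<Rightarrow> (complex^'n) set" where
  "mat_image a = range ((*v) a)"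

section \<open>C*-subalgebras and their state spaces\<close>

text \<open>No closedness is needed in finite dimension, and \<open>mat 1 \<in> A\<close> is not required.\<close>

definition cstar_subalgebra :: "(complex^'n^'n) set \<Rightarrow> bool" where
  "cstar_subalgebra A \<longleftrightarrow>
     cmat.subspace A \<and> (\<forall>a\<in>A. \<forall>b\<in>A. a ** b \<in> A) \<and> (\<forall>a\<in>A. conj_transpose a \<in> A)"

definition commutative_algebra :: "(complex^'n^'n) set \<Rightarrow> bool" where
  "commutative_algebra A \<longleftrightarrow> (\<forall>a\<in>A. \<forall>b\<in>A. a ** b = b ** a)"

definition state_space :: "(complex^'n^'n) set \<Rightarrow> (complex^'n^'n) set" where
  "state_space A = {\<rho> \<in> A. positive_semidefinite \<rho> \<and> trace \<rho> = 1}"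

section \<open>Relative entropy\<close>

definition eigenspace :: "complex^'n^'n \<Rightarrow> real \<Rightarrow> (complex^'n) set" where
  "eigenspace a l = {v. a *v v = complex_of_real l *s v}"

text \<open>The matrix of the orthogonal projection onto a complex subspace \<open>V\<close>: the unique
  self-adjoint idempotent with image \<open>V\<close>.\<close>

definition orth_projection :: "(complex^'n) set \<Rightarrow> complex^'n^'n" where
  "orth_projection V = (THE p. conj_transpose p = p \<and> p ** p = p \<and> mat_image p = V)"

text \<open>Logarithm of a positive semidefinite matrix, taken on its image by functional calculus
  and extended by \<open>0\<close> on the kernel: the kernel is the eigenspace for \<open>0\<close>, which is
  omitted from the spectral sum.\<close>

definition mat_log :: "complex^'n^'n \<Rightarrow> complex^'n^'n" where
  "mat_log a = (\<Sum>l | 0 < l \<and> eigenspace a l \<noteq> {0}. ln l *\<^sub>R orth_projection (eigenspace a l))"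

text \<open>For states the trace below is real, so taking the real part only changes the type.\<close>

definition relative_entropy :: "complex^'n^'n \<Rightarrow> complex^'n^'n \<Rightarrow> ereal" where
  "relative_entropy \<rho> \<sigma> =
     (if mat_image \<rho> \<subseteq> mat_image \<sigma>
      then ereal (Re (trace (\<rho> ** (mat_log \<rho> - mat_log \<sigma>))))
      else \<infinity>)"

definition entropy_I :: "complex^'n^'n \<Rightarrow> complex^'n^'n \<Rightarrow> ereal" where
  "entropy_I \<rho> \<sigma> = relative_entropy \<sigma> \<rho>"

definition entropy_rI :: "complex^'n^'n \<Rightarrow> complex^'n^'n \<Rightarrow> ereal" where
  "entropy_rI \<rho> \<sigma> = relative_entropy \<rho> \<sigma>"

section \<open>Convergences and topologies on the state space\<close>

definition entropy_conv ::
    "('a \<Rightarrow> 'a \<Rightarrow> ereal) \<Rightarrow> 'a set \<Rightarrow> ((nat \<Rightarrow> 'a) \<times> 'a) set" where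
  "entropy_conv D S =
     {(r, \<rho>). (\<forall>i. r i \<in> S) \<and> \<rho> \<in> S \<and> (\<lambda>i. D \<rho> (r i)) \<longlonglongrightarrow> 0}"

definition norm_conv :: "'a::topological_space set \<Rightarrow> ((nat \<Rightarrow> 'a) \<times> 'a) set" where
  "norm_conv S = {(r, \<rho>). (\<forall>i. r i \<in> S) \<and> \<rho> \<in> S \<and> r \<longlonglongrightarrow> \<rho>}"

definition conv_topology :: "'a set \<Rightarrow> ((nat \<Rightarrow> 'a) \<times> 'a) set \<Rightarrow> 'a topology" where
  "conv_topology S C = topology (\<lambda>U. U \<subseteq> S \<and>
     (\<forall>r \<rho>. \<rho> \<in> U \<longrightarrow> (r, \<rho>) \<in> C \<longrightarrow> (\<forall>\<^sub>F i in sequentially. r i \<in> U)))"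

lemma openin_conv_topology:
  "openin (conv_topology S C) U \<longleftrightarrow> U \<subseteq> S \<and>
     (\<forall>r \<rho>. \<rho> \<in> U \<longrightarrow> (r, \<rho>) \<in> C \<longrightarrow> (\<forall>\<^sub>F i in sequentially. r i \<in> U))"
proof -
  let ?P = "\<lambda>U. U \<subseteq> S \<and>
     (\<forall>r \<rho>. \<rho> \<in> U \<longrightarrow> (r, \<rho>) \<in> C \<longrightarrow> (\<forall>\<^sub>F i in sequentially. r i \<in> U))"
  have "istopology ?P"
    unfolding istopology_def
  proof (intro conjI allI impI)
    fix U V assume "?P U" "?P V"
    then show "U \<inter> V \<subseteq> S" by blast
    fix r \<rho> assume "\<rho> \<in> U \<inter> V" "(r, \<rho>) \<in> C"
    with \<open>?P U\<close> \<open>?P V\<close> show "\<forall>\<^sub>F i in sequentially. r i \<in> U \<inter> V"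
      by (auto simp: eventually_conj_iff)
  next
    fix K assume K: "\<forall>U\<in>K. ?P U"
    then show "\<Union>K \<subseteq> S" by blast
    fix r \<rho> assume "\<rho> \<in> \<Union>K" and c: "(r, \<rho>) \<in> C"
    then obtain U where "U \<in> K" "\<rho> \<in> U" by blast
    with K c have "\<forall>\<^sub>F i in sequentially. r i \<in> U" by blast
    then show "\<forall>\<^sub>F i in sequentially. r i \<in> \<Union>K"
      by (rule eventually_mono) (use \<open>U \<in> K\<close> in blast)
  qed
  then show ?thesis
    by (simp add: conv_topology_def)
qed

lemma topspace_conv_topology:
  assumes "C \<subseteq> {(r, \<rho>). \<forall>i. r i \<in> S}"
  shows "topspace (conv_topology S C) = S"
proof (rule antisym)
  show "topspace (conv_topology S C) \<subseteq> S"
    unfolding topspace_def openin_conv_topology by blast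
  have "openin (conv_topology S C) S"
    unfolding openin_conv_topology using assms by (auto intro!: always_eventually)
  then show "S \<subseteq> topspace (conv_topology S C)"
    by (rule openin_subset)
qed

definition C_I :: "(complex^'n^'n) set \<Rightarrow> ((nat \<Rightarrow> complex^'n^'n) \<times> (complex^'n^'n)) set" where
  "C_I A = entropy_conv entropy_I (state_space A)"

definition C_rI :: "(complex^'n^'n) set \<Rightarrow> ((nat \<Rightarrow> complex^'n^'n) \<times> (complex^'n^'n)) set" where
  "C_rI A = entropy_conv entropy_rI (state_space A)"

definition C_norm :: "(complex^'n^'n) set \<Rightarrow> ((nat \<Rightarrow> complex^'n^'n) \<times> (complex^'n^'n)) set" where
  "C_norm A = norm_conv (state_space A)"

definition T_I :: "(complex^'n^'n) set \<Rightarrow> (complex^'n^'n) topology" where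
  "T_I A = conv_topology (state_space A) (C_I A)"

definition T_rI :: "(complex^'n^'n) set \<Rightarrow> (complex^'n^'n) topology" where
  "T_rI A = conv_topology (state_space A) (C_rI A)"

definition T_norm :: "(complex^'n^'n) set \<Rightarrow> (complex^'n^'n) topology" where
  "T_norm A = top_of_set (state_space A)"

lemma topspace_T [simp]:
  "topspace (T_I A) = state_space A"
  "topspace (T_rI A) = state_space A"
  "topspace (T_norm A) = state_space A"
  unfolding T_I_def T_rI_def T_norm_def C_I_def C_rI_def entropy_conv_def
  by (auto intro!: topspace_conv_topology)

end

(* Expanding both states in their spectral projections P, Q turns the relative entropy into the
   double sum of |P Q|^2 (r ln r - r ln s - r + s) over pairs of eigenvalues r, s, while |rho - sigma|^2
   is the same sum of |P Q|^2 (r - s)^2.  Scalar inequalities then give |rho - sigma|^2 / 4 as a lower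
   bound for S(rho, sigma) and, while the eigenvalues s that matter stay away from 0, an upper bound
   vanishing with |rho - sigma|.  Hence I-convergence is norm convergence with eventually constant
   image, and rI-convergence implies norm convergence; the converse holds for commuting states,
   whose eigenvalues on a common eigenvector are close.

   Two orthogonal projections in the algebra separate the two convergences.  A projection not
   commuting with the algebra yields a norm-compact curve of states with pairwise incomparable
   images: their faces are separating T_I-open sets, and every subset of the curve is T_rI-closed. *)

theory Submission
  imports Defs
begin


section \<open>Complex matrices as a real Euclidean space\<close>

text \<open>The obstacle is the second argument of the entropy: its logarithm is large where small
  eigenvalues meet the support of the first argument. In the I case the second argument is the fixed
  limit, whose positive eigenvalues are bounded away from 0 once and for all. In the rI case it
  moves, and without commutativity an eigenvector of a small eigenvalue can tilt into the support of
  the limit; hence the gap hypotheses constrain only pairs of spectral projections that overlap. A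
  second constraint is that the identity matrix may lie outside the algebra. Spectral projections
  for nonzero eigenvalues are polynomials without constant term and stay inside, whereas the
  projection onto a kernel need not. Elements of the algebra are therefore built from nonzero
  eigenvalues, or from expressions such as \<open>b ** p - p ** b ** p\<close> in place of
  \<open>(mat 1 - p) ** b ** p\<close>.\<close>

lemma inner_complex_eq: "inner (x::complex) y = Re (cnj x * y)"
  by (simp add: inner_complex_def)

lemma matrix_mult_entry: "(a ** b) $ i $ j = (\<Sum>k\<in>UNIV. a $ i $ k * b $ k $ j)"
  by (simp add: matrix_matrix_mult_def)

lemma matrix_vector_entry: "(a *v x) $ i = (\<Sum>k\<in>UNIV. a $ i $ k * x $ k)"
  by (simp add: matrix_vector_mult_def)

lemma conj_transpose_entry [simp]: "conj_transpose a $ i $ j = cnj (a $ j $ i)"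
  by (simp add: conj_transpose_def)

lemma conj_transpose_conj_transpose [simp]: "conj_transpose (conj_transpose a) = a"
  by (simp add: vec_eq_iff)

lemma conj_transpose_mult: "conj_transpose (a ** b) = conj_transpose b ** conj_transpose a"
  by (simp add: vec_eq_iff matrix_mult_entry mult.commute)

lemma conj_transpose_add: "conj_transpose (a + b) = conj_transpose a + conj_transpose b"
  by (simp add: vec_eq_iff)

lemma conj_transpose_diff: "conj_transpose (a - b) = conj_transpose a - conj_transpose b"
  by (simp add: vec_eq_iff)

lemma conj_transpose_scaleR: "conj_transpose (r *\<^sub>R a) = r *\<^sub>R conj_transpose a"
  by (simp add: vec_eq_iff)

lemma conj_transpose_cmat_scale:
  "conj_transpose (cmat_scale c a) = cmat_scale (cnj c) (conj_transpose a)"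
  by (simp add: vec_eq_iff cmat_scale_def)

lemma conj_transpose_mat_1 [simp]: "conj_transpose (mat 1 :: complex^'n^'n) = mat 1"
  by (auto simp: vec_eq_iff mat_def)

lemma conj_transpose_zero [simp]: "conj_transpose 0 = 0"
  by (simp add: vec_eq_iff)

lemma bounded_linear_conj_transpose: "bounded_linear (conj_transpose :: complex^'n^'m \<Rightarrow> _)"
  by (intro linear_conv_bounded_linear[THEN iffD1] linearI)
    (simp_all add: conj_transpose_add conj_transpose_scaleR)

interpretation mm: bounded_bilinear
  "(**) :: complex^'n^'m \<Rightarrow> complex^'k^'n \<Rightarrow> complex^'k^'m"
  unfolding bilinear_conv_bounded_bilinear[symmetric] bilinear_def
  by (intro conjI allI linearI)
    (simp_all add: vec_eq_iff matrix_mult_entry algebra_simps sum.distrib scaleR_sum_right)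

interpretation mv: bounded_bilinear
  "(*v) :: complex^'n^'m \<Rightarrow> complex^'n \<Rightarrow> complex^'m"
  unfolding bilinear_conv_bounded_bilinear[symmetric] bilinear_def
  by (intro conjI allI linearI)
    (simp_all add: vec_eq_iff matrix_vector_entry algebra_simps sum.distrib scaleR_sum_right)

lemma bounded_linear_trace: "bounded_linear (trace :: complex^'n^'n \<Rightarrow> complex)"
  by (intro linear_conv_bounded_linear[THEN iffD1] linearI)
    (simp_all add: trace_def sum.distrib scaleR_sum_right)

lemma inner_matrix_vector:
  fixes a :: "complex^'n^'m"
  shows "inner (a *v x) y = inner x (conj_transpose a *v y)"
proof -
  have "inner (a *v x) y = Re (\<Sum>i\<in>UNIV. \<Sum>k\<in>UNIV. cnj (a $ i $ k) * cnj (x $ k) * y $ i)"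
    by (simp add: inner_vec_def inner_complex_eq matrix_vector_entry sum_distrib_right)
  also have "\<dots> = Re (\<Sum>k\<in>UNIV. \<Sum>i\<in>UNIV. cnj (a $ i $ k) * cnj (x $ k) * y $ i)"
    by (subst sum.swap) simp
  also have "\<dots> = inner x (conj_transpose a *v y)"
    by (simp add: inner_vec_def inner_complex_eq matrix_vector_entry sum_distrib_left mult_ac)
  finally show ?thesis .
qed

text \<open>Identifies the ambient Euclidean inner product with the real part of the Hilbert-Schmidt
  one, so that norm distances become traces and expand over spectral projections.\<close>

lemma Re_trace_mult:
  fixes a b :: "complex^'n^'n"
  shows "Re (trace (conj_transpose a ** b)) = inner a b"
proof -
  have "Re (trace (conj_transpose a ** b))
      = Re (\<Sum>i\<in>UNIV. \<Sum>k\<in>UNIV. cnj (a $ k $ i) * b $ k $ i)"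
    by (simp add: trace_def matrix_mult_entry)
  also have "\<dots> = Re (\<Sum>k\<in>UNIV. \<Sum>i\<in>UNIV. cnj (a $ k $ i) * b $ k $ i)"
    by (subst sum.swap) simp
  also have "\<dots> = inner a b"
    by (simp add: inner_vec_def inner_complex_eq)
  finally show ?thesis .
qed

text \<open>The Hilbert-Schmidt norm dominates the operator norm: Cauchy-Schwarz in each row, then
  the rows are collected.\<close>

lemma norm_matrix_vector_le:
  fixes a :: "complex^'n^'m"
  shows "norm (a *v x) \<le> norm a * norm x"
proof -
  have comp: "norm ((a *v x) $ i) \<le> norm (a $ i) * norm x" for i
  proof -
    have "norm ((a *v x) $ i) \<le> (\<Sum>k\<in>UNIV. \<bar>norm (a $ i $ k)\<bar> * \<bar>norm (x $ k)\<bar>)"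
      by (simp add: matrix_vector_entry norm_mult order_trans[OF norm_sum])
    also have "\<dots> \<le> norm (a $ i) * norm x"
      unfolding norm_vec_def by (rule L2_set_mult_ineq)
    finally show ?thesis .
  qed
  have "norm (a *v x) \<le> L2_set (\<lambda>i. norm (a $ i) * norm x) UNIV"
    unfolding norm_vec_def[of "a *v x"] by (intro L2_set_mono comp) auto
  also have "\<dots> = norm a * norm x"
    by (simp add: norm_vec_def[of a] L2_set_left_distrib)
  finally show ?thesis .
qed

lemma inner_complex_scale:
  fixes x y :: "complex^'n"
  shows "inner (c *s x) y = inner x (cnj c *s y)"
  by (simp add: inner_vec_def inner_complex_eq mult_ac)

lemma hermitian_inner:
  fixes a :: "complex^'n^'n"
  assumes "conj_transpose a = a"
  shows "inner (a *v x) y = inner x (a *v y)"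
  using inner_matrix_vector[of a x y] assms by simp

lemma matrix_scaleR_right: "a *v (r *\<^sub>R x) = r *\<^sub>R (a *v x)" for a :: "complex^'n^'n"
  by (rule mv.scaleR_right)

lemma of_real_smult: "complex_of_real l *s x = l *\<^sub>R x" for x :: "complex^'n"
  unfolding vec_eq_iff vector_smult_component vector_scaleR_component by (simp add: scaleR_conv_of_real)

lemma Re_trace_mult_self: "Re (trace (conj_transpose a ** a)) = (norm a)\<^sup>2" for a :: "complex^'n^'n"
  by (simp add: Re_trace_mult power2_norm_eq_inner)

lemma hermitian_trace:
  assumes "conj_transpose a = a"
  shows "trace a = of_real (Re (trace a))"
proof -
  have "cnj (trace a) = trace (conj_transpose a)"
    by (simp add: trace_def)
  with assms show ?thesis
    by (metis Reals_cnj_iff of_real_Re)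
qed

lemma positive_semidefinite_iff:
  "positive_semidefinite a \<longleftrightarrow> conj_transpose a = a \<and> (\<forall>x. 0 \<le> inner x (a *v x))"
  by (simp add: positive_semidefinite_def inner_vec_def inner_complex_eq)

lemma matrix_eq_0_iff: "a = 0 \<longleftrightarrow> (\<forall>x. a *v x = 0)" for a :: "complex^'n^'n"
  using matrix_eq[of a 0] by simp

section \<open>Orthogonal projections\<close>

definition is_projection :: "complex^'n^'n \<Rightarrow> bool" where
  "is_projection p \<longleftrightarrow> conj_transpose p = p \<and> p ** p = p"

lemma is_projection_image: "is_projection p \<Longrightarrow> mat_image p = {x. p *v x = x}"
  unfolding is_projection_def mat_image_def
  by (auto simp: matrix_vector_mul_assoc) (metis rangeI)

text \<open>Each projection fixes the common image, so \<open>q ** p = p\<close> and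
  \<open>p ** q = q\<close>; the adjoint of the first equation reads
  \<open>p ** q = p\<close>.\<close>

lemma projection_unique:
  assumes p: "is_projection p" and q: "is_projection q" and im: "mat_image p = mat_image q"
  shows "p = q"
proof -
  have "q ** p = p"
    using im is_projection_image[OF q] by (auto simp: matrix_eq mat_image_def matrix_vector_mul_assoc[symmetric])
  moreover have "p ** q = q"
    using im is_projection_image[OF p] by (auto simp: matrix_eq mat_image_def matrix_vector_mul_assoc[symmetric])
  ultimately show ?thesis
    using p q unfolding is_projection_def by (metis conj_transpose_mult)
qed

text \<open>Real orthogonal decomposition suffices: since \<open>V\<close> is closed under complex
  scalars, so is its real orthogonal complement, and uniqueness of the decomposition makes the
  projection map complex linear.\<close>

lemma projection_exists:
  fixes V :: "(complex^'n) set"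
  assumes sub: "subspace V" and scale: "\<And>c x. x \<in> V \<Longrightarrow> c *s x \<in> V"
  shows "\<exists>p. is_projection p \<and> mat_image p = V"
proof -
  have "\<exists>y z. y \<in> V \<and> (\<forall>w\<in>V. inner z w = 0) \<and> x = y + z" for x
    using orthogonal_subspace_decomp_exists[of V x] sub
    by (metis orthogonal_def span_eq_iff span_base)
  then obtain f where f: "\<And>x. f x \<in> V" "\<And>x w. w \<in> V \<Longrightarrow> inner (x - f x) w = 0"
    by (metis add_diff_cancel_left')
  have uniq: "f x = y" if "y \<in> V" "\<And>w. w \<in> V \<Longrightarrow> inner (x - y) w = 0" for x y
  proof -
    have "f x - y \<in> V" using f that sub by (simp add: subspace_diff)
    then have "inner (f x - y) (f x - y) = 0"
      using f(2)[of "f x - y" x] that(2)[of "f x - y"] by (simp add: inner_diff_left)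
    then show ?thesis by simp
  qed
  have add: "f (x + y) = f x + f y" for x y
    using f[of x] f[of y] f(2)[of _ x] f(2)[of _ y]
    by (intro uniq) (auto simp: subspace_add[OF sub] inner_diff_left inner_add_left)
  have smult: "f (c *s x) = c *s f x" for c x
  proof (rule uniq)
    show "c *s f x \<in> V" by (simp add: scale f)
    fix w assume "w \<in> V"
    then have "inner (c *s (x - f x)) w = 0"
      unfolding inner_complex_scale by (intro f scale)
    then show "inner (c *s x - c *s f x) w = 0"
      by (simp add: vector_sub_rdistrib vec.scale_right_diff_distrib)
  qed
  have lin: "Vector_Spaces.linear (*s) (*s) f"
    by unfold_locales (auto simp: add smult vector_space_over_itself.scale_right_distrib)
  define p where "p = matrix f"
  have pf: "p *v x = f x" for x
    unfolding p_def by (rule matrix_works[OF lin])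
  have fV: "f x = x" if "x \<in> V" for x
    using that by (intro uniq) auto
  have im: "mat_image p = V"
    unfolding mat_image_def pf using f(1) fV by (auto simp: image_iff) (metis fV)
  have "p ** p = p"
    by (simp add: matrix_eq matrix_vector_mul_assoc[symmetric] pf fV f)
  moreover have "conj_transpose p = p"
  proof -
    have eq: "inner (f x) y = inner x (f y)" for x y
      using f(2)[OF f(1)[of y], of x] f(2)[OF f(1)[of x], of y]
        inner_commute[of "f x" y] inner_commute[of "f x" "f y"]
      unfolding inner_diff_left by linarith
    have "inner x (conj_transpose p *v y - p *v y) = 0" for x y
      using eq[of x y] by (simp add: inner_diff_right inner_matrix_vector[symmetric] pf)
    then show ?thesis
      by (simp add: matrix_eq) (metis eq_iff_diff_eq_0 inner_eq_zero_iff)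
  qed
  ultimately show ?thesis
    using im unfolding is_projection_def by blast
qed

lemma orth_projection:
  fixes V :: "(complex^'n) set"
  assumes "subspace V" and "\<And>c x. x \<in> V \<Longrightarrow> c *s x \<in> V"
  shows "is_projection (orth_projection V)" and "mat_image (orth_projection V) = V"
proof -
  obtain p where p: "is_projection p" "mat_image p = V"
    using projection_exists[OF assms] by auto
  have "orth_projection V = p"
    unfolding orth_projection_def
    by (rule the_equality) (use p projection_unique in \<open>auto simp: is_projection_def\<close>)
  then show "is_projection (orth_projection V)" "mat_image (orth_projection V) = V"
    using p by auto
qed

text \<open>Cyclicity of the trace. This makes the overlaps in the double sums nonnegative, and zero
  exactly when the projections annihilate each other.\<close>

lemma inner_projections:
  assumes p: "is_projection p" and q: "is_projection q"
  shows "inner p q = (norm (p ** q))\<^sup>2"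
proof -
  have "(norm (p ** q))\<^sup>2 = Re (trace ((q ** p) ** (p ** q)))"
    using p q by (simp add: Re_trace_mult_self[symmetric] conj_transpose_mult is_projection_def)
  also have "(q ** p) ** (p ** q) = (q ** p) ** q"
    using p by (metis matrix_mul_assoc is_projection_def)
  also have "trace ((q ** p) ** q) = trace (q ** (q ** p))"
    by (rule trace_mul_sym)
  also have "q ** (q ** p) = q ** p"
    using q by (metis matrix_mul_assoc is_projection_def)
  also have "trace (q ** p) = trace (p ** q)" by (rule trace_mul_sym)
  also have "Re (trace (p ** q)) = inner p q"
    using p Re_trace_mult[of p q] by (simp add: is_projection_def)
  finally show ?thesis ..
qed

lemma projection_trace:
  assumes "is_projection p"
  shows "Re (trace p) = (norm p)\<^sup>2"
  using inner_projections[OF assms assms] assms Re_trace_mult[of p p]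
  by (simp add: is_projection_def)

lemma projection_norm_ge_1:
  assumes p: "is_projection p" and "p \<noteq> 0"
  shows "1 \<le> norm p"
proof -
  obtain x where x: "p *v x \<noteq> 0" using \<open>p \<noteq> 0\<close> matrix_eq_0_iff by blast
  have "p *v (p *v x) = p *v x"
    using p by (simp add: matrix_vector_mul_assoc is_projection_def)
  then have "norm (p *v x) \<le> norm p * norm (p *v x)"
    using norm_matrix_vector_le[of p "p *v x"] by simp
  then show ?thesis using x by simp
qed


section \<open>The spectral theorem for Hermitian matrices\<close>

text \<open>Real eigenvalues suffice for Hermitian matrices: \<open>sum_eproj\<close> shows that
  their eigenspaces already exhaust the space.\<close>

definition real_spectrum :: "complex^'n^'n \<Rightarrow> real set" where
  "real_spectrum a = {l. eigenspace a l \<noteq> {0}}"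

definition eproj :: "complex^'n^'n \<Rightarrow> real \<Rightarrow> complex^'n^'n" where
  "eproj a l = orth_projection (eigenspace a l)"

lemma mem_eigenspace: "v \<in> eigenspace a l \<longleftrightarrow> a *v v = l *\<^sub>R v"
  by (simp add: eigenspace_def of_real_smult)

lemma subspace_eigenspace: "subspace (eigenspace a l)"
  by (auto simp: subspace_def mem_eigenspace algebra_simps matrix_scaleR_right)

lemma scale_eigenspace: "x \<in> eigenspace a l \<Longrightarrow> c *s x \<in> eigenspace a l"
  by (simp add: eigenspace_def vector_scalar_commute vector_smult_assoc mult.commute)

lemma is_projection_eproj: "is_projection (eproj a l)"
  and mat_image_eproj: "mat_image (eproj a l) = eigenspace a l"
  unfolding eproj_def
  by (auto intro!: orth_projection subspace_eigenspace scale_eigenspace)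

lemma eproj_hermitian [simp]: "conj_transpose (eproj a l) = eproj a l"
  and eproj_idem [simp]: "eproj a l ** eproj a l = eproj a l"
  using is_projection_eproj[of a l] by (simp_all add: is_projection_def)

lemma eproj_in_eigenspace: "eproj a l *v x \<in> eigenspace a l"
  using mat_image_eproj[of a l] by (auto simp: mat_image_def)

lemma eproj_fix: "x \<in> eigenspace a l \<Longrightarrow> eproj a l *v x = x"
  using mat_image_eproj[of a l] is_projection_image[OF is_projection_eproj[of a l]] by auto

lemma mult_eproj: "a ** eproj a l = l *\<^sub>R eproj a l"
  using eproj_in_eigenspace[of a l]
  by (simp add: matrix_eq matrix_vector_mul_assoc[symmetric] mem_eigenspace mv.scaleR_left)

lemma eproj_mult:
  assumes "conj_transpose a = a"
  shows "eproj a l ** a = l *\<^sub>R eproj a l"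
  using arg_cong[OF mult_eproj[of a l], of conj_transpose] assms
  by (simp add: conj_transpose_mult conj_transpose_scaleR)

lemma eproj_eq_0_iff: "eproj a l = 0 \<longleftrightarrow> l \<notin> real_spectrum a"
proof
  assume "eproj a l = 0"
  then have "eigenspace a l = {0}"
    using mat_image_eproj[of a l] by (auto simp: mat_image_def)
  then show "l \<notin> real_spectrum a" by (simp add: real_spectrum_def)
next
  assume "l \<notin> real_spectrum a"
  then show "eproj a l = 0"
    using eproj_in_eigenspace[of a l] by (auto simp: real_spectrum_def matrix_eq_0_iff)
qed

lemma eigenspaces_orthogonal:
  assumes "conj_transpose a = a" "x \<in> eigenspace a l" "y \<in> eigenspace a m" "l \<noteq> m"
  shows "inner x y = 0"
  using hermitian_inner[OF assms(1), of x y] assms(2-4) by (simp add: mem_eigenspace)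

lemma eproj_mult_eproj:
  assumes "conj_transpose a = a" "l \<noteq> m"
  shows "eproj a l ** eproj a m = 0"
proof -
  have "inner (eproj a l *v (eproj a m *v x)) (eproj a l *v (eproj a m *v x)) = 0" for x
  proof -
    have "inner (eproj a l *v (eproj a m *v x)) (eproj a l *v (eproj a m *v x))
        = inner (eproj a m *v x) (eproj a l *v (eproj a l *v (eproj a m *v x)))"
      by (rule hermitian_inner) simp
    also have "\<dots> = 0"
      using eigenspaces_orthogonal[OF assms(1) eproj_in_eigenspace eproj_in_eigenspace] assms(2) by metis
    finally show ?thesis .
  qed
  then show ?thesis
    by (simp add: matrix_eq_0_iff matrix_vector_mul_assoc[symmetric])
qed

lemma finite_real_spectrum:
  fixes a :: "complex^'n^'n"
  assumes "conj_transpose a = a"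
  shows "finite (real_spectrum a)"
proof -
  have "\<exists>v. v \<noteq> 0 \<and> v \<in> eigenspace a l" if "l \<in> real_spectrum a" for l
    using that subspace_0[OF subspace_eigenspace[of a l]] unfolding real_spectrum_def by blast
  then obtain v where v: "\<And>l. l \<in> real_spectrum a \<Longrightarrow> v l \<noteq> 0 \<and> v l \<in> eigenspace a l"
    by metis
  have orth: "inner (v l) (v m) = 0" if "l \<in> real_spectrum a" "m \<in> real_spectrum a" "l \<noteq> m" for l m
    using eigenspaces_orthogonal[OF assms] v that by metis
  have inj: "inj_on v (real_spectrum a)"
    by (rule inj_onI) (metis orth v inner_eq_zero_iff)
  have "independent (v ` real_spectrum a)"
    by (rule pairwise_orthogonal_independent) (use v orth in \<open>force simp: pairwise_def orthogonal_def\<close>)+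
  then have "finite (v ` real_spectrum a)"
    by (rule independent_imp_finite)
  then show ?thesis
    using inj by (rule finite_imageD)
qed

text \<open>Maximising the Rayleigh quotient over the orthogonal complement of all eigenvectors would
  yield a further eigenvector; equality in Cauchy--Schwarz for the form \<open>\<lambda>(x,y) - (x,ay)\<close>
  replaces the use of Lagrange multipliers.\<close>

lemma span_eigenspaces:
  fixes a :: "complex^'n^'n"
  assumes h: "conj_transpose a = a"
  shows "span (\<Union>l. eigenspace a l) = UNIV"
proof (rule ccontr)
  define U where "U = span (\<Union>l. eigenspace a l)"
  define W where "W = {x. \<forall>y\<in>U. inner x y = 0}"
  assume "span (\<Union>l. eigenspace a l) \<noteq> UNIV"
  then obtain x0 where "x0 \<notin> U" by (auto simp: U_def)
  obtain y z where yz: "y \<in> U" "\<And>w. w \<in> U \<Longrightarrow> orthogonal z w" "x0 = y + z"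
    using orthogonal_subspace_decomp_exists[of "\<Union>l. eigenspace a l" x0] unfolding U_def by metis
  then have "z \<noteq> 0" "z \<in> W"
    using \<open>x0 \<notin> U\<close> by (auto simp: W_def orthogonal_def)
  have subU: "subspace U" unfolding U_def by simp
  have subW: "subspace W"
    by (auto simp: W_def subspace_def inner_add_left)
  have aU: "a *v u \<in> U" if "u \<in> U" for u
    using that unfolding U_def
  proof (induction rule: span_induct_alt)
    case base
    then show ?case by (simp add: span_zero)
  next
    case (step c x y)
    then obtain l where "a *v x = l *\<^sub>R x" by (auto simp: mem_eigenspace)
    then show ?case
      using step by (simp add: algebra_simps matrix_scaleR_right span_add span_mul span_base)
  qed
  have aW: "a *v w \<in> W" if "w \<in> W" for w
    using that aU by (auto simp: W_def hermitian_inner[OF h])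
  define K where "K = W \<inter> sphere 0 1"
  have "compact K"
    unfolding K_def using closed_subspace[OF subW] by (simp add: closed_Int_compact)
  moreover have "K \<noteq> {}"
    using \<open>z \<noteq> 0\<close> \<open>z \<in> W\<close> subspace_mul[OF subW, of z "inverse (norm z)"] by (auto simp: K_def intro!: exI[of _ "inverse (norm z) *\<^sub>R z"])
  moreover have "continuous_on K (\<lambda>x. inner x (a *v x))"
    by (intro continuous_intros mv.continuous_on)
  ultimately obtain x where x: "x \<in> K" and max: "\<And>y. y \<in> K \<Longrightarrow> inner y (a *v y) \<le> inner x (a *v x)"
    using continuous_attains_sup by metis
  define l where "l = inner x (a *v x)"
  have xW: "x \<in> W" and nx: "inner x x = 1"
    using x by (auto simp: K_def norm_eq_1)
  define B where "B = (\<lambda>u v. l * inner u v - inner u (a *v v))"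
  have B_pos: "0 \<le> B w w" if "w \<in> W" for w
  proof (cases "w = 0")
    case True then show ?thesis by (simp add: B_def)
  next
    case False
    define u where "u = inverse (norm w) *\<^sub>R w"
    have "u \<in> K"
      using False that subspace_mul[OF subW] by (auto simp: u_def K_def)
    then have "inner u (a *v u) \<le> l" unfolding l_def by (rule max)
    moreover have "inner u (a *v u) = (inverse (norm w))\<^sup>2 * inner w (a *v w)"
      by (simp add: u_def matrix_scaleR_right power2_eq_square)
    ultimately have "inner w (a *v w) \<le> l * (norm w)\<^sup>2"
      using False by (simp add: field_simps)
    then show ?thesis by (simp add: B_def power2_norm_eq_inner)
  qed
  have "B w x = 0" if w: "w \<in> W" for w
  proof -
    have Bx: "B x x = 0" by (simp add: B_def l_def nx)
    have sym: "B x w = B w x"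
      by (simp add: B_def inner_commute[of x] hermitian_inner[OF h])
    have exp: "B (x + t *\<^sub>R w) (x + t *\<^sub>R w) = 2 * t * B w x + t\<^sup>2 * B w w" for t
    proof -
      have "B (x + t *\<^sub>R w) (x + t *\<^sub>R w) = B x x + t * B x w + t * B w x + t\<^sup>2 * B w w"
        by (simp add: B_def inner_add_left inner_add_right algebra_simps matrix_scaleR_right power2_eq_square)
      then show ?thesis using Bx sym by simp
    qed
    have ge: "0 \<le> 2 * t * B w x + t\<^sup>2 * B w w" for t
      using B_pos[of "x + t *\<^sub>R w"] xW w subW exp[of t] by (simp add: subspace_add subspace_mul)
    have Bw: "0 \<le> B w w" using w by (rule B_pos)
    \<comment> \<open>Up to the denominator this minimises the quadratic in \<open>t\<close>. Adding
      1 to \<open>B w w\<close> keeps the denominator positive when the form vanishes at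
      \<open>w\<close>, and the value is still strictly negative unless
      \<open>B w x = 0\<close>.\<close>
    define t where "t = - B w x / (B w w + 1)"
    have "2 * t * B w x + t\<^sup>2 * B w w = - (B w x)\<^sup>2 * (B w w + 2) / (B w w + 1)\<^sup>2"
      using Bw unfolding t_def by (simp add: field_simps power2_eq_square add_nonneg_eq_0_iff)
    with ge[of t] have "0 \<le> - ((B w x)\<^sup>2 * (B w w + 2) / (B w w + 1)\<^sup>2)" by simp
    then have "(B w x)\<^sup>2 * (B w w + 2) / (B w w + 1)\<^sup>2 \<le> 0" by simp
    then show ?thesis
      using Bw by (simp add: divide_le_0_iff mult_le_0_iff)
  qed
  then have "inner w (l *\<^sub>R x - a *v x) = 0" if "w \<in> W" for w
    using that by (simp add: B_def inner_diff_right)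
  moreover have "l *\<^sub>R x - a *v x \<in> W"
    using xW aW subW by (simp add: subspace_diff subspace_mul)
  ultimately have "l *\<^sub>R x - a *v x = 0"
    using inner_eq_zero_iff by blast
  then have "x \<in> eigenspace a l" by (simp add: mem_eigenspace)
  then have "x \<in> U" unfolding U_def by (blast intro: span_base)
  then have "inner x x = 0" using xW by (simp add: W_def)
  then show False using nx by simp
qed

lemma sum_eproj:
  fixes a :: "complex^'n^'n"
  assumes h: "conj_transpose a = a"
  shows "(\<Sum>l\<in>real_spectrum a. eproj a l) = mat 1"
proof -
  have "(\<Sum>l\<in>real_spectrum a. eproj a l) *v x = x" for x
  proof -
    have "x \<in> span (\<Union>l. eigenspace a l)" using span_eigenspaces[OF h] by simp
    then show ?thesis
    proof (induction rule: span_induct_alt)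
      case base then show ?case by simp
    next
      case (step c x y)
      then obtain m where m: "x \<in> eigenspace a m" by auto
      have "eproj a l *v x = (if l = m then x else 0)" for l
      proof (cases "l = m")
        case False
        have "eproj a l *v x = (eproj a l ** eproj a m) *v x"
          using eproj_fix[OF m] by (simp add: matrix_vector_mul_assoc[symmetric])
        with False show ?thesis by (simp add: eproj_mult_eproj[OF h])
      qed (simp add: eproj_fix m)
      then have "(\<Sum>l\<in>real_spectrum a. eproj a l) *v x = (if m \<in> real_spectrum a then x else 0)"
        by (simp add: mv.sum_left finite_real_spectrum[OF h])
      \<comment> \<open>If \<open>m\<close> is not in the spectrum, its eigenspace is trivial and
        \<open>x\<close> is 0.\<close>
      also have "\<dots> = x"
        using m by (auto simp: real_spectrum_def)
      finally show ?case using step by (simp add: algebra_simps matrix_scaleR_right)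
    qed
  qed
  then show ?thesis by (simp add: matrix_eq)
qed

lemma spectral_decomposition:
  fixes a :: "complex^'n^'n"
  assumes h: "conj_transpose a = a"
  shows "a = (\<Sum>l\<in>real_spectrum a. l *\<^sub>R eproj a l)"
proof -
  have "a = a ** (\<Sum>l\<in>real_spectrum a. eproj a l)" by (simp add: sum_eproj[OF h])
  also have "\<dots> = (\<Sum>l\<in>real_spectrum a. l *\<^sub>R eproj a l)"
    by (simp only: mm.sum_right mult_eproj)
  finally show ?thesis .
qed

lemma norm_eq_sum_eproj:
  fixes a :: "complex^'n^'n"
  assumes h: "conj_transpose a = a"
  shows "(norm a)\<^sup>2 = (\<Sum>l\<in>real_spectrum a. l\<^sup>2 * (norm (eproj a l))\<^sup>2)"
    and "Re (trace a) = (\<Sum>l\<in>real_spectrum a. l * (norm (eproj a l))\<^sup>2)"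
proof -
  have "trace (a ** a) = (\<Sum>l\<in>real_spectrum a. trace (a ** (l *\<^sub>R eproj a l)))"
    by (subst (2) spectral_decomposition[OF h]) (simp only: mm.sum_right linear_sum[OF bounded_linear.linear[OF bounded_linear_trace]])
  also have "\<dots> = (\<Sum>l\<in>real_spectrum a. l\<^sup>2 *\<^sub>R trace (eproj a l))"
    by (intro sum.cong)
      (simp_all add: mm.scaleR_right mult_eproj power2_eq_square linear_scale[OF bounded_linear.linear[OF bounded_linear_trace]])
  finally have "Re (trace (a ** a)) = (\<Sum>l\<in>real_spectrum a. l\<^sup>2 * Re (trace (eproj a l)))"
    by simp
  then show "(norm a)\<^sup>2 = (\<Sum>l\<in>real_spectrum a. l\<^sup>2 * (norm (eproj a l))\<^sup>2)"
    using Re_trace_mult_self[of a] h by (simp add: projection_trace[OF is_projection_eproj])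
  have "trace a = (\<Sum>l\<in>real_spectrum a. l *\<^sub>R trace (eproj a l))"
    by (subst spectral_decomposition[OF h])
      (simp add: linear_sum[OF bounded_linear.linear[OF bounded_linear_trace]] linear_scale[OF bounded_linear.linear[OF bounded_linear_trace]])
  then show "Re (trace a) = (\<Sum>l\<in>real_spectrum a. l * (norm (eproj a l))\<^sup>2)"
    by (simp add: projection_trace[OF is_projection_eproj])
qed

lemma psd_spectrum_nonneg:
  assumes "positive_semidefinite a" "l \<in> real_spectrum a"
  shows "0 \<le> l"
proof -
  obtain v where v: "v \<noteq> 0" "a *v v = l *\<^sub>R v"
    using assms subspace_0[OF subspace_eigenspace[of a l]] unfolding real_spectrum_def mem_eigenspace[symmetric]
    by blast
  have "0 \<le> inner v (a *v v)" using assms(1) by (simp add: positive_semidefinite_iff)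
  then have "0 \<le> l * inner v v" using v by simp
  moreover have "0 < inner v v" using v(1) by simp
  ultimately show ?thesis by (simp add: zero_le_mult_iff)
qed

text \<open>Both \<open>b\<close> and its adjoint commute with \<open>a\<close> and so preserve the
  eigenspace. For its projection \<open>P\<close> this gives \<open>P b P = b P\<close> and, after
  taking the adjoint of the second relation, \<open>P b P = P b\<close>.\<close>

lemma eproj_commute:
  fixes a b :: "complex^'n^'n"
  assumes h: "conj_transpose a = a" and c: "a ** b = b ** a"
  shows "eproj a l ** b = b ** eproj a l"
proof -
  have *: "eproj a l ** c ** eproj a l = c ** eproj a l" if "a ** c = c ** a" for c
  proof -
    have "a *v (c *v (eproj a l *v x)) = l *\<^sub>R (c *v (eproj a l *v x))" for x
    proof -
      have "a *v (c *v (eproj a l *v x)) = c *v ((a ** eproj a l) *v x)"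
        by (metis matrix_vector_mul_assoc that)
      then show ?thesis by (simp add: mult_eproj mv.scaleR_left matrix_scaleR_right)
    qed
    then have "eproj a l *v (c *v (eproj a l *v x)) = c *v (eproj a l *v x)" for x
      by (intro eproj_fix) (simp add: mem_eigenspace)
    then show ?thesis by (simp add: matrix_eq matrix_vector_mul_assoc[symmetric])
  qed
  have c': "a ** conj_transpose b = conj_transpose b ** a"
    using arg_cong[OF c, of conj_transpose] h by (simp add: conj_transpose_mult)
  have "eproj a l ** b ** eproj a l = eproj a l ** b"
    using arg_cong[OF *[OF c'], of conj_transpose] by (simp add: conj_transpose_mult matrix_mul_assoc)
  with *[OF c] show ?thesis by simp
qed

text \<open>The image of a Hermitian matrix is the orthogonal complement of its kernel, and kernels
  are easier to compare.\<close>

lemma image_subset_iff_kernel: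
  fixes a b :: "complex^'n^'n"
  assumes a: "conj_transpose a = a" and b: "conj_transpose b = b"
  shows "mat_image a \<subseteq> mat_image b \<longleftrightarrow> (\<forall>x. b *v x = 0 \<longrightarrow> a *v x = 0)"
proof
  assume sub: "mat_image a \<subseteq> mat_image b"
  show "\<forall>x. b *v x = 0 \<longrightarrow> a *v x = 0"
  proof (intro allI impI)
    fix x assume x: "b *v x = 0"
    obtain y where y: "a *v (a *v x) = b *v y"
      using sub by (force simp: mat_image_def)
    have "inner (a *v x) (a *v x) = inner x (b *v y)"
      by (simp add: hermitian_inner[OF a] y)
    also have "\<dots> = inner (b *v x) y" by (simp add: hermitian_inner[OF b])
    finally show "a *v x = 0" using x by simp
  qed
next
  assume ker: "\<forall>x. b *v x = 0 \<longrightarrow> a *v x = 0"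
  have "b *v (eproj b 0 *v x) = 0" for x
    using eproj_in_eigenspace[of b 0 x] by (simp add: mem_eigenspace)
  then have "a ** eproj b 0 = 0"
    using ker by (simp add: matrix_eq_0_iff matrix_vector_mul_assoc[symmetric])
  from arg_cong[OF this, of conj_transpose] have z: "eproj b 0 ** a = 0"
    using a by (simp add: conj_transpose_mult)
  \<comment> \<open>This is the pseudo-inverse of \<open>b\<close> times \<open>a\<close>. The term
    for eigenvalue 0 drops out because \<open>inverse 0 = 0\<close>, and \<open>z\<close> says that
    nothing is lost there.\<close>
  define c where "c = (\<Sum>l\<in>real_spectrum b. inverse l *\<^sub>R (eproj b l ** a))"
  have "a = (\<Sum>l\<in>real_spectrum b. eproj b l ** a)"
    by (simp add: mm.sum_left[symmetric] sum_eproj[OF b])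
  also have "\<dots> = (\<Sum>l\<in>real_spectrum b. inverse l *\<^sub>R (b ** eproj b l ** a))"
  proof (intro sum.cong refl)
    fix l
    show "eproj b l ** a = inverse l *\<^sub>R (b ** eproj b l ** a)"
      by (cases "l = 0") (auto simp: mult_eproj mm.scaleR_left z)
  qed
  also have "\<dots> = b ** c"
    by (simp add: c_def mm.sum_right mm.scaleR_right matrix_mul_assoc)
  finally have "a *v x = b *v (c *v x)" for x
    by (metis matrix_vector_mul_assoc)
  then show "mat_image a \<subseteq> mat_image b" by (auto simp: mat_image_def)
qed


section \<open>Spectral projections inside a C*-subalgebra\<close>

lemma cstar_mult: "cstar_subalgebra A \<Longrightarrow> a \<in> A \<Longrightarrow> b \<in> A \<Longrightarrow> a ** b \<in> A"
  and cstar_conj_transpose: "cstar_subalgebra A \<Longrightarrow> a \<in> A \<Longrightarrow> conj_transpose a \<in> A"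
  by (auto simp: cstar_subalgebra_def)

lemma cmat_scale_of_real: "cmat_scale (complex_of_real r) a = r *\<^sub>R a"
  unfolding vec_eq_iff vector_scaleR_component cmat_scale_def by (simp add: scaleR_conv_of_real)

lemma cstar_cmat_scale: "cstar_subalgebra A \<Longrightarrow> a \<in> A \<Longrightarrow> cmat_scale c a \<in> A"
  by (simp add: cstar_subalgebra_def cmat.subspace_scale)

lemma cstar_subspace:
  assumes "cstar_subalgebra A"
  shows "subspace A"
  unfolding subspace_def
proof (intro conjI ballI allI)
  have A: "cmat.subspace A" using assms by (simp add: cstar_subalgebra_def)
  show "0 \<in> A" by (rule cmat.subspace_0[OF A])
  show "x + y \<in> A" if "x \<in> A" "y \<in> A" for x y by (rule cmat.subspace_add[OF A that])
  show "c *\<^sub>R x \<in> A" if "x \<in> A" for c x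
    using cmat.subspace_scale[OF A that, of "complex_of_real c"] by (simp add: cmat_scale_of_real)
qed

text \<open>Lagrange interpolation with a factor \<open>m\<close> in front: the sum in
  \<open>poly\<close> is \<open>a\<close> times the product of the factors \<open>a - k\<close>, a
  polynomial without constant term, which stays in an algebra that may lack the identity. Taking all
  other eigenvalues for \<open>M\<close> leaves only the term of \<open>l\<close>.\<close>

lemma eproj_mem:
  assumes A: "cstar_subalgebra A" and a: "a \<in> A" and h: "conj_transpose a = a" and l: "l \<noteq> 0"
  shows "eproj a l \<in> A"
proof -
  note sub = cstar_subspace[OF A]
  have poly: "(\<Sum>m\<in>real_spectrum a. (m * (\<Prod>k\<in>M. m - k)) *\<^sub>R eproj a m) \<in> A" if "finite M" for M
    using that
  proof (induction M)
    case empty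
    then show ?case using a spectral_decomposition[OF h] by simp
  next
    case (insert k M)
    define x where "x = (\<Sum>m\<in>real_spectrum a. (m * (\<Prod>k\<in>M. m - k)) *\<^sub>R eproj a m)"
    have "(\<Sum>m\<in>real_spectrum a. (m * (\<Prod>k\<in>insert k M. m - k)) *\<^sub>R eproj a m) = a ** x - k *\<^sub>R x"
      using insert.hyps
      by (simp add: x_def mm.sum_right mm.scaleR_right mult_eproj scaleR_sum_right
          sum_subtractf[symmetric] algebra_simps)
    moreover have "x \<in> A" unfolding x_def by (rule insert.IH)
    ultimately show ?case
      using sub a by (simp add: subspace_diff subspace_mul cstar_mult[OF A])
  qed
  show ?thesis
  proof (cases "l \<in> real_spectrum a")
    case False
    then show ?thesis using sub by (simp add: eproj_eq_0_iff[THEN iffD2] subspace_0)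
  next
    case True
    define M where "M = real_spectrum a - {l}"
    define c where "c = l * (\<Prod>k\<in>M. l - k)"
    have fin: "finite (real_spectrum a)" by (rule finite_real_spectrum[OF h])
    then have "c \<noteq> 0" using l by (simp add: c_def M_def)
    have "(\<Sum>m\<in>real_spectrum a. (m * (\<Prod>k\<in>M. m - k)) *\<^sub>R eproj a m) = (\<Sum>m\<in>{l}. c *\<^sub>R eproj a m)"
      using True fin by (intro sum.mono_neutral_cong_right) (auto simp: M_def c_def)
    then have "c *\<^sub>R eproj a l \<in> A"
      using poly[of M] fin by (simp add: M_def)
    then have "inverse c *\<^sub>R (c *\<^sub>R eproj a l) \<in> A" using sub by (simp only: subspace_mul)
    then show ?thesis using \<open>c \<noteq> 0\<close> by simp
  qed
qed

section \<open>Relative entropy as a double sum over spectra\<close>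

text \<open>The sum may include the eigenvalue 0 because \<open>ln 0 = 0\<close>; the logarithm then
  runs over the same index set as the spectral decomposition.\<close>

lemma mat_log_eq_sum:
  assumes "positive_semidefinite a"
  shows "mat_log a = (\<Sum>l\<in>real_spectrum a. ln l *\<^sub>R eproj a l)"
proof -
  have h: "conj_transpose a = a" using assms by (simp add: positive_semidefinite_iff)
  show ?thesis
    unfolding mat_log_def eproj_def[symmetric]
    using psd_spectrum_nonneg[OF assms]
    by (intro sum.mono_neutral_cong_left)
      (auto simp: finite_real_spectrum[OF h], auto simp: real_spectrum_def less_le)
qed

definition spectral_weight :: "complex^'n^'n \<Rightarrow> complex^'n^'n \<Rightarrow> real \<Rightarrow> real \<Rightarrow> real" where
  "spectral_weight a b r s = inner (eproj a r) (eproj b s)"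

lemma spectral_weight_eq: "spectral_weight a b r s = (norm (eproj a r ** eproj b s))\<^sup>2"
  unfolding spectral_weight_def by (intro inner_projections is_projection_eproj)

lemma inner_spectral_sums:
  "inner (\<Sum>r\<in>real_spectrum a. f r *\<^sub>R eproj a r) (\<Sum>s\<in>real_spectrum b. g s *\<^sub>R eproj b s)
    = (\<Sum>r\<in>real_spectrum a. \<Sum>s\<in>real_spectrum b. spectral_weight a b r s * (f r * g s))"
  unfolding inner_sum_left unfolding inner_sum_right by (simp add: spectral_weight_def mult_ac)

lemma hermitian_mult_spectral_sum:
  assumes "conj_transpose a = a"
  shows "a ** (\<Sum>r\<in>real_spectrum a. f r *\<^sub>R eproj a r) = (\<Sum>r\<in>real_spectrum a. (r * f r) *\<^sub>R eproj a r)"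
  by (simp add: mm.sum_right mm.scaleR_right mult_eproj mult.commute)

lemma hermitian_spectral_sum:
  "conj_transpose (\<Sum>r\<in>real_spectrum a. f r *\<^sub>R eproj a r) = (\<Sum>r\<in>real_spectrum a. f r *\<^sub>R eproj a r)"
  by (simp add: linear_sum[OF bounded_linear.linear[OF bounded_linear_conj_transpose]] conj_transpose_scaleR)

lemma Re_trace_inner_left: "Re (trace a) = inner a (mat 1)" if "conj_transpose a = a"
  using Re_trace_mult[of a "mat 1"] that by simp

lemma mat_1_spectral_sum:
  assumes "conj_transpose a = a"
  shows "mat 1 = (\<Sum>r\<in>real_spectrum a. 1 *\<^sub>R eproj a r)"
  using sum_eproj[OF assms] by simp

text \<open>Each square term involves one matrix only; pairing it with the other matrix's resolution
  of the identity brings it into the same double sum as the mixed term.\<close>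

lemma norm_diff_eq_sum:
  fixes a b :: "complex^'n^'n"
  assumes a: "conj_transpose a = a" and b: "conj_transpose b = b"
  shows "(norm (a - b))\<^sup>2
    = (\<Sum>r\<in>real_spectrum a. \<Sum>s\<in>real_spectrum b. spectral_weight a b r s * (r - s)\<^sup>2)"
proof -
  let ?w = "spectral_weight a b"
  have aa: "inner a a = (\<Sum>r\<in>real_spectrum a. \<Sum>s\<in>real_spectrum b. ?w r s * (r * r * 1))"
  proof -
    have eq: "a ** a = (\<Sum>r\<in>real_spectrum a. (r * r) *\<^sub>R eproj a r)"
      using hermitian_mult_spectral_sum[OF a, of "\<lambda>r. r"] spectral_decomposition[OF a] by simp
    have "inner a a = inner (a ** a) (mat 1)"
      using Re_trace_mult[of a a] Re_trace_inner_left[of "a ** a"] a by (simp add: conj_transpose_mult)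
    then show ?thesis
      unfolding eq mat_1_spectral_sum[OF b] inner_spectral_sums .
  qed
  have bb: "inner b b = (\<Sum>r\<in>real_spectrum a. \<Sum>s\<in>real_spectrum b. ?w r s * (1 * (s * s)))"
  proof -
    have eq: "b ** b = (\<Sum>r\<in>real_spectrum b. (r * r) *\<^sub>R eproj b r)"
      using hermitian_mult_spectral_sum[OF b, of "\<lambda>r. r"] spectral_decomposition[OF b] by simp
    have "inner b b = inner (mat 1) (b ** b)"
      using Re_trace_mult[of b b] Re_trace_inner_left[of "b ** b"] b by (simp add: conj_transpose_mult inner_commute)
    then show ?thesis
      unfolding eq mat_1_spectral_sum[OF a] inner_spectral_sums .
  qed
  have ab: "inner a b = (\<Sum>r\<in>real_spectrum a. \<Sum>s\<in>real_spectrum b. ?w r s * (r * s))"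
    by (subst spectral_decomposition[OF a], subst spectral_decomposition[OF b])
      (rule inner_spectral_sums)
  have "(norm (a - b))\<^sup>2 = inner a a + inner b b - 2 * inner a b"
    by (simp add: power2_norm_eq_inner inner_diff_left inner_diff_right inner_commute)
  then show ?thesis
    unfolding aa bb ab
    by (simp add: sum_distrib_left sum.distrib[symmetric] sum_subtractf[symmetric]
        algebra_simps power2_eq_square)
qed

text \<open>The terms \<open>- r + s\<close> contribute the difference of the traces, which is 0.
  For positive \<open>r\<close> and \<open>s\<close> they turn the summand into the Bregman
  divergence of \<open>x ln x\<close>, so that estimates can be made summand by summand.\<close>

lemma entropy_eq_sum:
  fixes a b :: "complex^'n^'n"
  assumes pa: "positive_semidefinite a" and pb: "positive_semidefinite b"
    and tr: "trace a = trace b"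
  shows "Re (trace (a ** (mat_log a - mat_log b)))
    = (\<Sum>r\<in>real_spectrum a. \<Sum>s\<in>real_spectrum b.
        spectral_weight a b r s * (r * ln r - r * ln s - r + s))"
proof -
  let ?w = "spectral_weight a b"
  have a: "conj_transpose a = a" and b: "conj_transpose b = b"
    using pa pb by (simp_all add: positive_semidefinite_iff)
  have e: "a ** mat_log a = (\<Sum>r\<in>real_spectrum a. (r * ln r) *\<^sub>R eproj a r)"
    unfolding mat_log_eq_sum[OF pa] by (rule hermitian_mult_spectral_sum[OF a])
  have "Re (trace (a ** mat_log a)) = inner (a ** mat_log a) (mat 1)"
    by (rule Re_trace_inner_left) (simp add: e hermitian_spectral_sum)
  then have aa: "Re (trace (a ** mat_log a))
      = (\<Sum>r\<in>real_spectrum a. \<Sum>s\<in>real_spectrum b. ?w r s * (r * ln r * 1))"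
    unfolding e mat_1_spectral_sum[OF b] inner_spectral_sums .
  have "Re (trace (a ** mat_log b)) = inner a (mat_log b)"
    using Re_trace_mult[of a "mat_log b"] a by simp
  then have ab: "Re (trace (a ** mat_log b))
      = (\<Sum>r\<in>real_spectrum a. \<Sum>s\<in>real_spectrum b. ?w r s * (r * ln s))"
    unfolding mat_log_eq_sum[OF pb]
    by (subst (asm) spectral_decomposition[OF a]) (simp add: inner_spectral_sums)
  have ta: "Re (trace a) = (\<Sum>r\<in>real_spectrum a. \<Sum>s\<in>real_spectrum b. ?w r s * (r * 1))"
    unfolding Re_trace_inner_left[OF a] mat_1_spectral_sum[OF b]
    by (subst spectral_decomposition[OF a]) (rule inner_spectral_sums)
  have tb: "Re (trace b) = (\<Sum>r\<in>real_spectrum a. \<Sum>s\<in>real_spectrum b. ?w r s * (1 * s))"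
    unfolding Re_trace_inner_left[OF b] inner_commute[of b] mat_1_spectral_sum[OF a]
    by (subst spectral_decomposition[OF b]) (rule inner_spectral_sums)
  have "Re (trace (a ** (mat_log a - mat_log b)))
      = Re (trace (a ** mat_log a)) - Re (trace (a ** mat_log b)) - Re (trace a) + Re (trace b)"
    by (simp add: mm.diff_right linear_diff[OF bounded_linear.linear[OF bounded_linear_trace]] tr)
  then show ?thesis
    unfolding aa ab ta tb
    by (simp add: sum.distrib[symmetric] sum_subtractf[symmetric] algebra_simps)
qed

section \<open>Two-sided bounds for the relative entropy\<close>

text \<open>With \<open>u\<close> and \<open>v\<close> the square roots,
  \<open>ln x <= x - 1\<close> at \<open>v / u\<close> bounds the kernel below by
  \<open>(u - v)^2\<close>. Since \<open>u + v\<close> is at most 2, passing to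
  \<open>(r - s)^2\<close> costs a factor 4.\<close>

lemma entropy_kernel_ge:
  fixes r s :: real
  assumes "0 < r" "r \<le> 1" "0 < s" "s \<le> 1"
  shows "(r - s)\<^sup>2 / 4 \<le> r * ln r - r * ln s - r + s"
proof -
  define u v where "u = sqrt r" and "v = sqrt s"
  have uv: "0 < u" "u \<le> 1" "0 < v" "v \<le> 1" "r = u\<^sup>2" "s = v\<^sup>2"
    using assms by (simp_all add: u_def v_def)
  have "ln (v / u) \<le> v / u - 1" using uv by (simp add: ln_le_minus_one)
  then have "2 * u\<^sup>2 * ln (v / u) \<le> 2 * u\<^sup>2 * (v / u - 1)"
    using uv by (simp add: mult_left_mono)
  also have "\<dots> = 2 * u * v - 2 * u\<^sup>2" using uv by (simp add: field_simps power2_eq_square)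
  finally have "r * ln s - r * ln r \<le> 2 * u * v - 2 * r"
    using uv by (simp add: ln_div ln_realpow algebra_simps)
  then have h: "(u - v)\<^sup>2 \<le> r * ln r - r * ln s - r + s"
    using uv by (simp add: power2_eq_square algebra_simps)
  have "(u + v)\<^sup>2 \<le> 2\<^sup>2" using uv by (intro power_mono) auto
  then have "(u - v)\<^sup>2 * (u + v)\<^sup>2 \<le> (u - v)\<^sup>2 * 4" by (intro mult_left_mono) auto
  moreover have "(r - s)\<^sup>2 = (u - v)\<^sup>2 * (u + v)\<^sup>2"
    using uv by (simp add: power2_eq_square algebra_simps)
  ultimately show ?thesis using h by simp
qed

text \<open>The same logarithm bound at \<open>r / s\<close> gives the chi-square term
  \<open>(r - s)^2 / s\<close>; this is where small eigenvalues of the second argument do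
  harm.\<close>

lemma entropy_kernel_le:
  fixes r s c :: real
  assumes "0 < r" "0 < c" "c \<le> s"
  shows "r * ln r - r * ln s - r + s \<le> (r - s)\<^sup>2 / c"
proof -
  have "ln (r / s) \<le> r / s - 1" using assms by (simp add: ln_le_minus_one)
  then have "r * ln (r / s) \<le> r * (r / s - 1)" using assms by (simp add: mult_left_mono)
  then have "r * ln r - r * ln s - r + s \<le> r * (r / s - 1) - r + s"
    using assms by (simp add: ln_div algebra_simps)
  also have "\<dots> = (r - s)\<^sup>2 / s" using assms by (simp add: field_simps power2_eq_square)
  also have "\<dots> \<le> (r - s)\<^sup>2 / c" using assms by (intro divide_left_mono) auto
  finally show ?thesis .
qed

text \<open>A nonzero spectral projection has squared norm at least 1, so \<open>r\<close> is at
  most its own contribution to the trace, and the other contributions are nonnegative.\<close>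

lemma state_eigenvalue_le_1:
  assumes p: "positive_semidefinite a" and tr: "trace a = 1" and r: "r \<in> real_spectrum a"
  shows "r \<le> 1"
proof -
  have h: "conj_transpose a = a" using p by (simp add: positive_semidefinite_iff)
  have r0: "0 \<le> r" using psd_spectrum_nonneg[OF p r] .
  have "1 \<le> norm (eproj a r)"
    using r by (intro projection_norm_ge_1 is_projection_eproj) (simp add: eproj_eq_0_iff)
  then have "r * 1 \<le> r * (norm (eproj a r))\<^sup>2"
    using r0 by (intro mult_left_mono) (auto simp: one_le_power)
  also have "\<dots> \<le> (\<Sum>l\<in>real_spectrum a. l * (norm (eproj a l))\<^sup>2)"
    using r psd_spectrum_nonneg[OF p] by (intro member_le_sum) (auto simp: finite_real_spectrum[OF h])
  also have "\<dots> = 1" using norm_eq_sum_eproj(2)[OF h] tr by simp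
  finally show ?thesis by simp
qed

text \<open>Gives weight zero to the pairs with \<open>s = 0\<close> and \<open>r > 0\<close>, whose
  summand for an eigenvalue \<open>r\<close> of a state would be the negative number
  \<open>r * ln r - r\<close> under the convention \<open>ln 0 = 0\<close>.\<close>

lemma image_subset_eproj_0:
  assumes a: "conj_transpose a = a" and b: "conj_transpose b = b"
    and im: "mat_image a \<subseteq> mat_image b" and r: "r \<noteq> 0"
  shows "eproj a r ** eproj b 0 = 0"
proof -
  have "b *v (eproj b 0 *v x) = 0" for x
    using eproj_in_eigenspace[of b 0 x] by (simp add: mem_eigenspace)
  then have "a ** eproj b 0 = 0"
    using im by (simp add: image_subset_iff_kernel[OF a b] matrix_eq_0_iff matrix_vector_mul_assoc[symmetric])
  then have "(eproj a r ** a) ** eproj b 0 = 0"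
    by (metis matrix_mul_assoc mm.zero_right)
  then show ?thesis using r by (simp add: eproj_mult[OF a] mm.scaleR_left)
qed

lemma relative_entropy_ge:
  fixes a b :: "complex^'n^'n"
  assumes pa: "positive_semidefinite a" "trace a = 1" and pb: "positive_semidefinite b" "trace b = 1"
  shows "ereal ((norm (a - b))\<^sup>2 / 4) \<le> relative_entropy a b"
proof (cases "mat_image a \<subseteq> mat_image b")
  case True
  have a: "conj_transpose a = a" and b: "conj_transpose b = b"
    using pa pb by (simp_all add: positive_semidefinite_iff)
  have "spectral_weight a b r s * (r - s)\<^sup>2 / 4
      \<le> spectral_weight a b r s * (r * ln r - r * ln s - r + s)"
    if r: "r \<in> real_spectrum a" and s: "s \<in> real_spectrum b" for r s
  proof -
    have rs: "0 \<le> r" "0 \<le> s" "r \<le> 1" "s \<le> 1"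
      using psd_spectrum_nonneg pa pb state_eigenvalue_le_1 r s by metis+
    have w: "0 \<le> spectral_weight a b r s" by (simp add: spectral_weight_eq)
    \<comment> \<open>For \<open>r = 0\<close> the kernel equals \<open>s\<close>, which is at least
      \<open>s^2 / 4\<close> because eigenvalues of states are at most 1. In the second case the
      inclusion of images annihilates the weight.\<close>
    consider "r = 0" | "r \<noteq> 0" "s = 0" | "0 < r" "0 < s" using rs by linarith
    then show ?thesis
    proof cases
      case 1
      have "s\<^sup>2 \<le> s" using rs by (simp add: power2_eq_square mult_left_le)
      then have "s\<^sup>2 / 4 \<le> s" using rs by simp
      then show ?thesis using 1 mult_left_mono[OF _ w, of "s\<^sup>2 / 4" s] by simp
    next
      case 2
      then have "spectral_weight a b r s = 0"
        using image_subset_eproj_0[OF a b True] by (simp add: spectral_weight_eq)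
      then show ?thesis by simp
    next
      case 3
      then show ?thesis
        using mult_left_mono[OF entropy_kernel_ge[of r s] w] rs by simp
    qed
  qed
  then have "(norm (a - b))\<^sup>2 / 4 \<le> Re (trace (a ** (mat_log a - mat_log b)))"
    using pa pb by (simp add: norm_diff_eq_sum[OF a b] entropy_eq_sum sum_divide_distrib sum_mono)
  then show ?thesis using True by (simp add: relative_entropy_def)
qed (simp add: relative_entropy_def)

text \<open>\<open>p\<close> is orthogonal to \<open>mat 1 - p\<close> in the trace inner product,
  so its squared norm is \<open>inner p (mat 1)\<close>, and Cauchy-Schwarz applies.\<close>

lemma projection_norm_le:
  fixes p :: "complex^'n^'n"
  assumes p: "is_projection p"
  shows "norm p \<le> norm (mat 1 :: complex^'n^'n)"
proof -
  have "inner p (mat 1 - p) = Re (trace (p ** (mat 1 - p)))"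
    using p Re_trace_mult[of p "mat 1 - p"] by (simp add: is_projection_def)
  also have "p ** (mat 1 - p) = 0" using p by (simp add: mm.diff_right is_projection_def)
  finally have "inner p (mat 1) = inner p p" by (simp add: inner_diff_right trace_def)
  then have "inner p p \<le> norm p * norm (mat 1 :: complex^'n^'n)"
    using norm_cauchy_schwarz[of p "mat 1"] by simp
  then show ?thesis
    by (cases "p = 0") (simp_all add: power2_norm_eq_inner[symmetric] power2_eq_square)
qed

text \<open>Pairs with \<open>r > 0\<close> are controlled by the quadratic bound, for which only
  the eigenvalues \<open>s\<close> overlapping the support of \<open>a\<close> must stay above
  \<open>c\<close>. Pairs with \<open>r = 0\<close> contribute the weight of \<open>b\<close> on the
  kernel of \<open>a\<close>, which is linear in the distance; hence the second summand.\<close>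

lemma relative_entropy_le:
  fixes a b :: "complex^'n^'n"
  assumes pa: "positive_semidefinite a" "trace a = 1" and pb: "positive_semidefinite b" "trace b = 1"
    and im: "mat_image a \<subseteq> mat_image b" and c: "0 < c"
    and gap: "\<And>r s. 0 < r \<Longrightarrow> 0 \<le> s \<Longrightarrow> eproj a r ** eproj b s \<noteq> 0 \<Longrightarrow> c \<le> s"
  shows "relative_entropy a b
    \<le> ereal ((norm (a - b))\<^sup>2 / c + norm (mat 1 :: complex^'n^'n) * norm (a - b))"
proof -
  let ?w = "spectral_weight a b"
  have a: "conj_transpose a = a" and b: "conj_transpose b = b"
    using pa pb by (simp_all add: positive_semidefinite_iff)
  have term_le: "?w r s * (r * ln r - r * ln s - r + s)
      \<le> ?w r s * (r - s)\<^sup>2 / c + (if r = 0 then ?w 0 s * s else 0)"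
    if r: "r \<in> real_spectrum a" and s: "s \<in> real_spectrum b" for r s
  proof -
    have rs: "0 \<le> r" "0 \<le> s"
      using psd_spectrum_nonneg pa pb r s by metis+
    have w: "0 \<le> ?w r s" by (simp add: spectral_weight_eq)
    consider "r = 0" | "?w r s = 0" | "0 < r" "eproj a r ** eproj b s \<noteq> 0"
      using rs by (force simp: spectral_weight_eq)
    then show ?thesis
    proof cases
      case 3
      then have "r * ln r - r * ln s - r + s \<le> (r - s)\<^sup>2 / c"
        using c gap rs by (intro entropy_kernel_le) auto
      then show ?thesis using mult_left_mono[OF _ w] 3 by fastforce
    qed (use w c in \<open>auto simp: spectral_weight_eq\<close>)
  qed
  have "(\<Sum>r\<in>real_spectrum a. \<Sum>s\<in>real_spectrum b. if r = 0 then ?w 0 s * s else 0)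
      \<le> norm (mat 1 :: complex^'n^'n) * norm (a - b)"
  proof (cases "0 \<in> real_spectrum a")
    case True
    have "(\<Sum>r\<in>real_spectrum a. \<Sum>s\<in>real_spectrum b. if r = 0 then ?w 0 s * s else 0)
        = (\<Sum>r\<in>real_spectrum a. if r = 0 then (\<Sum>s\<in>real_spectrum b. ?w 0 s * s) else 0)"
      by (intro sum.cong) auto
    also have "\<dots> = (\<Sum>s\<in>real_spectrum b. ?w 0 s * s)"
      using True by (simp add: finite_real_spectrum[OF a])
    also have "\<dots> = inner (eproj a 0) b"
      by (subst (2) spectral_decomposition[OF b]) (simp add: inner_sum_right spectral_weight_def mult.commute)
    \<comment> \<open>\<open>a\<close> vanishes against its own kernel projection, so subtracting it
      turns the weight of \<open>b\<close> on that kernel into a distance.\<close>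
    also have "\<dots> = inner (eproj a 0) (b - a)"
      using Re_trace_mult[of "eproj a 0" a] eproj_mult[OF a, of 0] by (simp add: inner_diff_right trace_def)
    also have "\<dots> \<le> norm (eproj a 0) * norm (a - b)"
      using norm_cauchy_schwarz[of "eproj a 0" "b - a"] by (simp add: norm_minus_commute)
    also have "\<dots> \<le> norm (mat 1 :: complex^'n^'n) * norm (a - b)"
      by (intro mult_right_mono projection_norm_le is_projection_eproj) auto
    finally show ?thesis .
  next
    case False
    have "(\<Sum>r\<in>real_spectrum a. \<Sum>s\<in>real_spectrum b. if r = 0 then ?w 0 s * s else 0) = 0"
      using False by (intro sum.neutral ballI) auto
    then show ?thesis by simp
  qed
  moreover have "Re (trace (a ** (mat_log a - mat_log b)))
    \<le> (\<Sum>r\<in>real_spectrum a. \<Sum>s\<in>real_spectrum b.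
         ?w r s * (r - s)\<^sup>2 / c + (if r = 0 then ?w 0 s * s else 0))"
    using pa pb by (simp only: entropy_eq_sum) (intro sum_mono term_le)
  moreover have "(\<Sum>r\<in>real_spectrum a. \<Sum>s\<in>real_spectrum b. ?w r s * (r - s)\<^sup>2 / c) = (norm (a - b))\<^sup>2 / c"
    by (simp add: norm_diff_eq_sum[OF a b] sum_divide_distrib)
  ultimately have "Re (trace (a ** (mat_log a - mat_log b)))
      \<le> (norm (a - b))\<^sup>2 / c + norm (mat 1 :: complex^'n^'n) * norm (a - b)"
    by (simp add: sum.distrib)
  then show ?thesis using im by (simp add: relative_entropy_def)
qed


section \<open>Convergence in relative entropy\<close>

lemma stateD:
  assumes "a \<in> state_space A"
  shows "a \<in> A" "positive_semidefinite a" "trace a = 1" "conj_transpose a = a"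
  using assms by (auto simp: state_space_def positive_semidefinite_iff)

lemma relative_entropy_ge_state:
  "a \<in> state_space A \<Longrightarrow> b \<in> state_space A \<Longrightarrow> ereal ((norm (a - b))\<^sup>2 / 4) \<le> relative_entropy a b"
  by (rule relative_entropy_ge[OF stateD(2,3) stateD(2,3)])

text \<open>Both arguments vary so that the statement serves either order of the entropy.\<close>

lemma entropy_tendsto_imp_diff_tendsto:
  assumes x: "\<And>i. x i \<in> state_space A" and y: "\<And>i. y i \<in> state_space A"
    and lim: "(\<lambda>i. relative_entropy (x i) (y i)) \<longlonglongrightarrow> 0"
  shows "(\<lambda>i. x i - y i) \<longlonglongrightarrow> 0"
proof -
  have "(\<lambda>i. ereal ((norm (x i - y i))\<^sup>2 / 4)) \<longlonglongrightarrow> ereal 0"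
  proof (rule tendsto_sandwich[OF _ _ tendsto_const])
    show "\<forall>\<^sub>F i in sequentially. ereal 0 \<le> ereal ((norm (x i - y i))\<^sup>2 / 4)"
      by simp
    show "\<forall>\<^sub>F i in sequentially. ereal ((norm (x i - y i))\<^sup>2 / 4) \<le> relative_entropy (x i) (y i)"
      by (intro always_eventually allI relative_entropy_ge_state[OF x y])
  qed (use lim in \<open>simp add: zero_ereal_def[symmetric]\<close>)
  then have "(\<lambda>i. (norm (x i - y i))\<^sup>2 / 4) \<longlonglongrightarrow> 0"
    by (simp only: lim_ereal)
  from tendsto_real_sqrt[OF tendsto_mult[OF tendsto_const[of 4] this]] have "(\<lambda>i. norm (x i - y i)) \<longlonglongrightarrow> 0" by simp
  then show ?thesis by (rule tendsto_norm_zero_cancel)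
qed

lemma entropy_tendsto_imp_image_subset:
  fixes x y :: "nat \<Rightarrow> complex^'n^'n"
  assumes lim: "(\<lambda>i. relative_entropy (x i) (y i)) \<longlonglongrightarrow> 0"
  shows "\<forall>\<^sub>F i in sequentially. mat_image (x i) \<subseteq> mat_image (y i)"
proof -
  have *: "mat_image a \<subseteq> mat_image b" if "relative_entropy a b < \<infinity>" for a b :: "complex^'n^'n"
    using that by (rule contrapos_pp) (simp add: relative_entropy_def)
  have "\<forall>\<^sub>F i in sequentially. relative_entropy (x i) (y i) < \<infinity>"
    using lim by (rule order_tendstoD) simp
  then show ?thesis
    by (rule eventually_mono) (rule *)
qed

text \<open>The constant \<open>c\<close> is uniform in \<open>i\<close>, so the upper bound tends
  to 0 with the distance.\<close>

lemma entropy_tendsto_0I: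
  fixes x y :: "nat \<Rightarrow> complex^'n^'n"
  assumes x: "\<And>i. x i \<in> state_space A" and y: "\<And>i. y i \<in> state_space A"
    and c: "0 < c" and lim: "(\<lambda>i. x i - y i) \<longlonglongrightarrow> 0"
    and im: "\<forall>\<^sub>F i in sequentially. mat_image (x i) \<subseteq> mat_image (y i)"
    and gap: "\<forall>\<^sub>F i in sequentially. \<forall>r s. 0 < r \<longrightarrow> 0 \<le> s \<longrightarrow> eproj (x i) r ** eproj (y i) s \<noteq> 0 \<longrightarrow> c \<le> s"
  shows "(\<lambda>i. relative_entropy (x i) (y i)) \<longlonglongrightarrow> 0"
proof (rule tendsto_sandwich[OF _ _ tendsto_const])
  let ?N = "norm (mat 1 :: complex^'n^'n)"
  show "\<forall>\<^sub>F i in sequentially. 0 \<le> relative_entropy (x i) (y i)"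
  proof (rule always_eventually, rule allI)
    fix i show "0 \<le> relative_entropy (x i) (y i)"
      by (rule order_trans[OF _ relative_entropy_ge_state[OF x y]]) (simp add: zero_ereal_def[symmetric])
  qed
  show "\<forall>\<^sub>F i in sequentially. relative_entropy (x i) (y i)
      \<le> ereal ((norm (x i - y i))\<^sup>2 / c + ?N * norm (x i - y i))"
    using im gap
  proof eventually_elim
    case (elim i)
    show ?case
      by (rule relative_entropy_le[OF stateD(2,3)[OF x] stateD(2,3)[OF y] elim(1) c]) (use elim(2) in blast)
  qed
  have "(\<lambda>i. (norm (x i - y i))\<^sup>2 / c + ?N * norm (x i - y i)) \<longlonglongrightarrow> 0\<^sup>2 / c + ?N * 0"
    by (rule tendsto_add[OF tendsto_divide[OF tendsto_power[OF tendsto_norm_zero[OF lim]] tendsto_const]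
          tendsto_mult[OF tendsto_const tendsto_norm_zero[OF lim]]]) (use c in simp)
  then have "(\<lambda>i. (norm (x i - y i))\<^sup>2 / c + ?N * norm (x i - y i)) \<longlonglongrightarrow> 0" by simp
  then have "(\<lambda>i. ereal ((norm (x i - y i))\<^sup>2 / c + ?N * norm (x i - y i))) \<longlonglongrightarrow> ereal 0"
    by (simp only: lim_ereal)
  then show "(\<lambda>i. ereal ((norm (x i - y i))\<^sup>2 / c + ?N * norm (x i - y i))) \<longlonglongrightarrow> 0"
    by (simp only: zero_ereal_def)
qed

text \<open>For positive semidefinite matrices this says that the nonzero eigenvalues are at least
  \<open>c\<close>. The quadratic form is preferred because its change under perturbation is
  estimated directly, without following individual eigenvalues.\<close>

definition spectral_gap :: "complex^'n^'n \<Rightarrow> real \<Rightarrow> bool" where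
  "spectral_gap a c \<longleftrightarrow> (\<forall>x\<in>mat_image a. c * (norm x)\<^sup>2 \<le> inner x (a *v x))"

lemma positive_eigenvalues_bounded_below:
  fixes a :: "complex^'n^'n"
  assumes h: "conj_transpose a = a"
  obtains c where "0 < c" "\<And>l. l \<in> real_spectrum a \<Longrightarrow> 0 < l \<Longrightarrow> c \<le> l"
proof
  \<comment> \<open>Inserting 1 keeps the minimum defined when there is no positive
    eigenvalue.\<close>
  let ?L = "insert 1 {l \<in> real_spectrum a. 0 < l}"
  have fin: "finite ?L" using finite_real_spectrum[OF h] by simp
  show "0 < Min ?L" using fin by (subst Min_gr_iff) auto
  show "Min ?L \<le> l" if "l \<in> real_spectrum a" "0 < l" for l
    using fin that by (intro Min_le) auto
qed

lemma spectral_gap_exists: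
  fixes a :: "complex^'n^'n"
  assumes p: "positive_semidefinite a"
  obtains c where "0 < c" "spectral_gap a c"
proof -
  have h: "conj_transpose a = a" using p by (simp add: positive_semidefinite_iff)
  obtain c where c: "0 < c" "\<And>l. l \<in> real_spectrum a \<Longrightarrow> 0 < l \<Longrightarrow> c \<le> l"
    using positive_eigenvalues_bounded_below[OF h] by blast
  have "c * (norm x)\<^sup>2 \<le> inner x (a *v x)" if x: "x \<in> mat_image a" for x
  proof -
    obtain y where "x = a *v y" using x unfolding mat_image_def by blast
    then have x0: "eproj a 0 *v x = 0"
      using eproj_mult[OF h, of 0] by (simp add: matrix_vector_mul_assoc)
    have sq: "inner x (eproj a l *v x) = (norm (eproj a l *v x))\<^sup>2" for l
      unfolding power2_norm_eq_inner hermitian_inner[OF eproj_hermitian]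
      by (simp add: matrix_vector_mul_assoc)
    have "inner x (a *v x) - c * (norm x)\<^sup>2 = inner x (a *v x) - c * inner x (mat 1 *v x)"
      by (simp add: power2_norm_eq_inner)
    also have ax: "a *v x = (\<Sum>l\<in>real_spectrum a. l *\<^sub>R (eproj a l *v x))"
      by (subst spectral_decomposition[OF h]) (simp add: mv.sum_left mv.scaleR_left)
    also have "mat 1 *v x = (\<Sum>l\<in>real_spectrum a. eproj a l *v x)"
      by (simp only: sum_eproj[OF h, symmetric] mv.sum_left)
    also have "inner x (\<Sum>l\<in>real_spectrum a. l *\<^sub>R (eproj a l *v x)) - c * inner x (\<Sum>l\<in>real_spectrum a. eproj a l *v x)
        = (\<Sum>l\<in>real_spectrum a. (l - c) * (norm (eproj a l *v x))\<^sup>2)"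
      by (simp add: inner_sum_right sq sum_distrib_left sum_subtractf[symmetric] left_diff_distrib)
    \<comment> \<open>A negative coefficient \<open>l - c\<close> can occur only at
      \<open>l = 0\<close>, and a vector in the image has no component along the kernel.\<close>
    also have "\<dots> \<ge> 0"
    proof (rule sum_nonneg)
      fix l assume "l \<in> real_spectrum a"
      then consider "l = 0" | "c \<le> l"
        using c psd_spectrum_nonneg[OF p] by fastforce
      then show "0 \<le> (l - c) * (norm (eproj a l *v x))\<^sup>2"
        by cases (auto simp: x0)
    qed
    finally show ?thesis unfolding ax by simp
  qed
  then show thesis using c that by (auto simp: spectral_gap_def)
qed

text \<open>The quadratic form moves by at most \<open>d\<close> times the squared norm of the
  vector; the inclusion of images makes the gap of \<open>a\<close> available there.\<close>

lemma spectral_gap_perturb: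
  assumes gap: "spectral_gap a c" and im: "mat_image b \<subseteq> mat_image a" and d: "norm (b - a) \<le> d"
  shows "spectral_gap b (c - d)"
  unfolding spectral_gap_def
proof
  fix x assume "x \<in> mat_image b"
  then have "c * (norm x)\<^sup>2 \<le> inner x (a *v x)" using gap im by (auto simp: spectral_gap_def)
  moreover have "\<bar>inner x ((b - a) *v x)\<bar> \<le> d * (norm x)\<^sup>2"
  proof -
    have "\<bar>inner x ((b - a) *v x)\<bar> \<le> norm x * norm ((b - a) *v x)" by (rule Cauchy_Schwarz_ineq2)
    also have "\<dots> \<le> norm x * (d * norm x)"
      using norm_matrix_vector_le[of "b - a" x] mult_right_mono[OF d, of "norm x"]
      by (intro mult_left_mono) auto
    finally show ?thesis by (simp add: power2_eq_square mult_ac)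
  qed
  ultimately show "(c - d) * (norm x)\<^sup>2 \<le> inner x (b *v x)"
    by (simp add: mv.diff_left inner_diff_right left_diff_distrib abs_le_iff)
qed

text \<open>Overlap with the support of \<open>a\<close> forces \<open>s\<close> to be nonzero, so
  the range of \<open>eproj b s\<close> lies in the image of \<open>b\<close>, where the gap
  applies. This supplies the gap hypothesis of \<open>relative_entropy_le\<close>.\<close>

lemma spectral_gap_eigenvalue:
  assumes a: "conj_transpose a = a" and b: "conj_transpose b = b"
    and im: "mat_image a \<subseteq> mat_image b" and gap: "spectral_gap b c"
    and r: "0 < r" and ne: "eproj a r ** eproj b s \<noteq> 0"
  shows "c \<le> s"
proof -
  have "s \<noteq> 0" using image_subset_eproj_0[OF a b im] r ne by auto
  obtain v where "eproj a r *v (eproj b s *v v) \<noteq> 0"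
    using ne by (auto simp: matrix_eq_0_iff matrix_vector_mul_assoc[symmetric])
  then have x: "eproj b s *v v \<noteq> 0" by auto
  define x where "x = eproj b s *v v"
  have bx: "b *v x = s *\<^sub>R x"
    using eproj_in_eigenspace[of b s v] by (simp add: x_def mem_eigenspace)
  then have "b *v (inverse s *\<^sub>R x) = x" using \<open>s \<noteq> 0\<close> by (simp add: matrix_scaleR_right)
  then have "x \<in> mat_image b" by (metis mat_image_def rangeI)
  then have "c * (norm x)\<^sup>2 \<le> s * (norm x)\<^sup>2"
    using gap bx by (auto simp: spectral_gap_def power2_norm_eq_inner)
  then show ?thesis using x by (simp add: x_def)
qed

text \<open>A perturbation smaller than the gap cannot shrink the support: if \<open>b\<close> kills
  \<open>x\<close>, it also kills the component \<open>u\<close> of \<open>x\<close> in the image of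
  \<open>a\<close>. Then the form of \<open>a\<close> at \<open>u\<close> equals that of
  \<open>a - b\<close>, too small for the gap unless \<open>u = 0\<close>.\<close>

lemma spectral_gap_image_eq:
  assumes a: "conj_transpose a = a" and b: "conj_transpose b = b"
    and gap: "spectral_gap a c" and im: "mat_image b \<subseteq> mat_image a" and d: "norm (b - a) < c"
  shows "mat_image b = mat_image a"
proof
  show "mat_image a \<subseteq> mat_image b"
    unfolding image_subset_iff_kernel[OF a b]
  proof (intro allI impI)
    fix x assume x: "b *v x = 0"
    define u where "u = x - eproj a 0 *v x"
    have a0: "a *v (eproj a 0 *v x) = 0"
      using eproj_in_eigenspace[of a 0 x] by (simp add: mem_eigenspace)
    then have "b *v (eproj a 0 *v x) = 0"
      using im image_subset_iff_kernel[OF b a] by blast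
    then have bu: "b *v u = 0" using x by (simp add: u_def mv.diff_right)
    have "eproj a 0 *v u = 0" by (simp add: u_def mv.diff_right matrix_vector_mul_assoc)
    have "u \<in> mat_image a"
    proof -
      have "u = (\<Sum>l\<in>real_spectrum a. eproj a l *v u)"
        by (simp only: mv.sum_left[symmetric] sum_eproj[OF a] matrix_vector_mul_lid)
      also have "\<dots> = (\<Sum>l\<in>real_spectrum a. a *v (inverse l *\<^sub>R (eproj a l *v u)))"
      proof (intro sum.cong refl)
        fix l show "eproj a l *v u = a *v (inverse l *\<^sub>R (eproj a l *v u))"
          using eproj_in_eigenspace[of a l u] \<open>eproj a 0 *v u = 0\<close>
          by (cases "l = 0") (auto simp: mem_eigenspace matrix_scaleR_right)
      qed
      also have "\<dots> = a *v (\<Sum>l\<in>real_spectrum a. inverse l *\<^sub>R (eproj a l *v u))"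
        by (rule mv.sum_right[symmetric])
      finally show ?thesis unfolding mat_image_def by (rule range_eqI)
    qed
    then have "c * (norm u)\<^sup>2 \<le> inner u (a *v u)" using gap by (auto simp: spectral_gap_def)
    also have "\<dots> = inner u ((a - b) *v u)" using bu by (simp add: mv.diff_left)
    also have "\<dots> \<le> norm u * norm ((a - b) *v u)" by (rule norm_cauchy_schwarz)
    also have "\<dots> \<le> norm u * (norm (a - b) * norm u)"
      by (intro mult_left_mono norm_matrix_vector_le) auto
    finally have "c * (norm u)\<^sup>2 \<le> norm (b - a) * (norm u)\<^sup>2"
      by (simp add: power2_eq_square mult_ac norm_minus_commute)
    then have "u = 0" using d by (simp add: mult_le_cancel_right)
    then have "x = eproj a 0 *v x" by (simp add: u_def)
    then show "a *v x = 0" using a0 by simp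
  qed
qed (rule im)

section \<open>The two convergences in terms of norms and images\<close>

lemma C_rI_imp_norm:
  assumes "(r, \<rho>) \<in> C_rI A"
  shows "r \<longlonglongrightarrow> \<rho>" and "\<forall>\<^sub>F i in sequentially. mat_image \<rho> \<subseteq> mat_image (r i)"
proof -
  have S: "\<And>i. r i \<in> state_space A" "\<rho> \<in> state_space A"
    and lim: "(\<lambda>i. relative_entropy \<rho> (r i)) \<longlonglongrightarrow> 0"
    using assms by (auto simp: C_rI_def entropy_conv_def entropy_rI_def)
  have "(\<lambda>i. \<rho> - r i) \<longlonglongrightarrow> 0"
    by (rule entropy_tendsto_imp_diff_tendsto[OF _ _ lim]) (rule S)+
  from tendsto_diff[OF tendsto_const[of \<rho>] this] show "r \<longlonglongrightarrow> \<rho>" by simp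
  show "\<forall>\<^sub>F i in sequentially. mat_image \<rho> \<subseteq> mat_image (r i)"
    by (rule entropy_tendsto_imp_image_subset[OF lim])
qed

text \<open>Finite entropy puts the image of \<open>r i\<close> inside that of the limit, and the
  gap of the limit makes a nearby state fill it. Conversely, the gap belongs to the fixed limit,
  which gives the uniform constant.\<close>

lemma C_I_iff:
  "(r, \<rho>) \<in> C_I A \<longleftrightarrow> (\<forall>i. r i \<in> state_space A) \<and> \<rho> \<in> state_space A \<and> r \<longlonglongrightarrow> \<rho> \<and>
     (\<forall>\<^sub>F i in sequentially. mat_image (r i) = mat_image \<rho>)"
proof (cases "(\<forall>i. r i \<in> state_space A) \<and> \<rho> \<in> state_space A")
  case True
  then have r: "\<And>i. r i \<in> state_space A" and \<rho>: "\<rho> \<in> state_space A" by auto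
  obtain c where c: "0 < c" "spectral_gap \<rho> c"
    using spectral_gap_exists[OF stateD(2)[OF \<rho>]] by blast
  have "(\<lambda>i. relative_entropy (r i) \<rho>) \<longlonglongrightarrow> 0 \<longleftrightarrow>
    r \<longlonglongrightarrow> \<rho> \<and> (\<forall>\<^sub>F i in sequentially. mat_image (r i) = mat_image \<rho>)" (is "?L \<longleftrightarrow> ?R")
  proof
    assume lim: ?L
    have "(\<lambda>i. r i - \<rho>) \<longlonglongrightarrow> 0"
      by (rule entropy_tendsto_imp_diff_tendsto[OF _ _ lim]) (rule r \<rho>)+
    then have conv: "r \<longlonglongrightarrow> \<rho>" by (rule LIM_zero_cancel)
    have "\<forall>\<^sub>F i in sequentially. norm (r i - \<rho>) < c"
      using conv c(1) by (simp add: tendsto_iff dist_norm)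
    moreover have "\<forall>\<^sub>F i in sequentially. mat_image (r i) \<subseteq> mat_image \<rho>"
      by (rule entropy_tendsto_imp_image_subset[OF lim])
    ultimately have "\<forall>\<^sub>F i in sequentially. mat_image (r i) = mat_image \<rho>"
      by eventually_elim (rule spectral_gap_image_eq[OF stateD(4)[OF \<rho>] stateD(4)[OF r] c(2)])
    with conv show ?R by blast
  next
    assume R: ?R
    then have im: "\<forall>\<^sub>F i in sequentially. mat_image (r i) \<subseteq> mat_image \<rho>"
      by (auto elim: eventually_mono)
    show ?L
    proof (rule entropy_tendsto_0I[OF r \<rho> c(1) _ im])
      show "(\<lambda>i. r i - \<rho>) \<longlonglongrightarrow> 0" using R LIM_zero by blast
      show "\<forall>\<^sub>F i in sequentially. \<forall>l s. 0 < l \<longrightarrow> 0 \<le> s \<longrightarrow> eproj (r i) l ** eproj \<rho> s \<noteq> 0 \<longrightarrow> c \<le> s"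
        using im
        by (rule eventually_mono) (use spectral_gap_eigenvalue[OF stateD(4)[OF r] stateD(4)[OF \<rho>] _ c(2)] in blast)
    qed
  qed
  with True show ?thesis by (simp add: C_I_def entropy_conv_def entropy_I_def)
qed (auto simp: C_I_def entropy_conv_def)

text \<open>With the arguments exchanged the gap is needed for \<open>r i\<close>. Equality of
  images transfers it from the limit, and half of it survives once the distance is below
  \<open>c / 2\<close>.\<close>

lemma C_I_subset_C_rI: "C_I A \<subseteq> C_rI A"
proof
  fix p assume p: "p \<in> C_I A"
  obtain r \<rho> where p_eq: "p = (r, \<rho>)" by (cases p)
  then have r: "\<And>i. r i \<in> state_space A" and \<rho>: "\<rho> \<in> state_space A" and conv: "r \<longlonglongrightarrow> \<rho>"
    and im: "\<forall>\<^sub>F i in sequentially. mat_image (r i) = mat_image \<rho>"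
    using p by (auto simp: C_I_iff)
  obtain c where c: "0 < c" "spectral_gap \<rho> c"
    using spectral_gap_exists[OF stateD(2)[OF \<rho>]] by blast
  have close: "\<forall>\<^sub>F i in sequentially. norm (r i - \<rho>) < c / 2"
    using tendstoD[OF conv, of "c / 2"] c(1) by (simp add: dist_norm)
  have "(\<lambda>i. relative_entropy \<rho> (r i)) \<longlonglongrightarrow> 0"
  proof (rule entropy_tendsto_0I[where c = "c / 2", OF \<rho> r])
    show "0 < c / 2" using c by simp
    show "(\<lambda>i. \<rho> - r i) \<longlonglongrightarrow> 0"
      using tendsto_diff[OF tendsto_const[of \<rho>] conv] by simp
    show "\<forall>\<^sub>F i in sequentially. mat_image \<rho> \<subseteq> mat_image (r i)"
      using im by (rule eventually_mono) auto
    show "\<forall>\<^sub>F i in sequentially. \<forall>l s. 0 < l \<longrightarrow> 0 \<le> s \<longrightarrow> eproj \<rho> l ** eproj (r i) s \<noteq> 0 \<longrightarrow> c / 2 \<le> s"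
      using im close
    proof eventually_elim
      case (elim i)
      have "spectral_gap (r i) (c - c / 2)"
        by (rule spectral_gap_perturb[OF c(2)]) (use elim in auto)
      then have "spectral_gap (r i) (c / 2)" by simp
      then show ?case
        using spectral_gap_eigenvalue[OF stateD(4)[OF \<rho>] stateD(4)[OF r[of i]]] elim by blast
    qed
  qed
  then show "p \<in> C_rI A"
    using r \<rho> p_eq by (simp add: C_rI_def entropy_conv_def entropy_rI_def)
qed

text \<open>The spectral projections commute as well, so their nonzero product has a common
  eigenvector in its range, on which \<open>a - b\<close> acts as the scalar
  \<open>r - s\<close>.\<close>

lemma commuting_eigenvalue_bound:
  assumes a: "conj_transpose a = a" and b: "conj_transpose b = b" and comm: "a ** b = b ** a"
    and ne: "eproj a r ** eproj b s \<noteq> 0"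
  shows "\<bar>r - s\<bar> \<le> norm (a - b)"
proof -
  have "b ** eproj a r = eproj a r ** b" using eproj_commute[OF a comm] by simp
  from eproj_commute[OF b this, of s]
  have c: "eproj a r ** eproj b s = eproj b s ** eproj a r" by simp
  obtain v where v: "(eproj a r ** eproj b s) *v v \<noteq> 0" using ne by (auto simp: matrix_eq_0_iff)
  define x where "x = (eproj a r ** eproj b s) *v v"
  have "a *v x = r *\<^sub>R x"
    unfolding x_def matrix_vector_mul_assoc[symmetric]
    using eproj_in_eigenspace[of a r] by (simp add: mem_eigenspace)
  moreover have "b *v x = s *\<^sub>R x"
    unfolding x_def c matrix_vector_mul_assoc[symmetric]
    using eproj_in_eigenspace[of b s] by (simp add: mem_eigenspace)
  ultimately have "(a - b) *v x = (r - s) *\<^sub>R x"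
    by (simp add: mv.diff_left scaleR_left_diff_distrib)
  then have "\<bar>r - s\<bar> * norm x \<le> norm (a - b) * norm x"
    using norm_matrix_vector_le[of "a - b" x] by simp
  then show ?thesis using v by (simp add: x_def)
qed

text \<open>An eigenvalue of \<open>r i\<close> that overlaps a positive eigenvalue of the limit is
  close to it, hence at least half the lower bound \<open>c\<close>. This one estimate gives the gap
  and, applied to the eigenvalue 0 of \<open>r i\<close>, the inclusion of images.\<close>

lemma commuting_norm_conv_imp_C_rI:
  assumes r: "\<And>i. r i \<in> state_space A" and \<rho>: "\<rho> \<in> state_space A" and conv: "r \<longlonglongrightarrow> \<rho>"
    and comm: "\<And>i. \<rho> ** r i = r i ** \<rho>"
  shows "(r, \<rho>) \<in> C_rI A"
proof -
  note h = stateD(4)[OF \<rho>] and hr = stateD(4)[OF r]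
  obtain c where c: "0 < c" "\<And>l. l \<in> real_spectrum \<rho> \<Longrightarrow> 0 < l \<Longrightarrow> c \<le> l"
    using positive_eigenvalues_bounded_below[OF h] by blast
  have close: "\<forall>\<^sub>F i in sequentially. norm (\<rho> - r i) < c / 2"
    using tendstoD[OF conv, of "c / 2"] c(1) by (simp add: dist_norm norm_minus_commute)
  have gap: "c / 2 \<le> s"
    if "norm (\<rho> - r i) < c / 2" "0 < l" "eproj \<rho> l ** eproj (r i) s \<noteq> 0" for i l s
  proof -
    have "l \<in> real_spectrum \<rho>" using that(3) eproj_eq_0_iff[of \<rho> l] by auto
    then have "c \<le> l" using c that by simp
    then show ?thesis
      using commuting_eigenvalue_bound[OF h hr comm that(3)] that(1) by linarith
  qed
  have "(\<lambda>i. relative_entropy \<rho> (r i)) \<longlonglongrightarrow> 0"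
  proof (rule entropy_tendsto_0I[where c = "c / 2", OF \<rho> r])
    show "0 < c / 2" using c by simp
    show "(\<lambda>i. \<rho> - r i) \<longlonglongrightarrow> 0"
      using tendsto_diff[OF tendsto_const[of \<rho>] conv] by simp
    show "\<forall>\<^sub>F i in sequentially. \<forall>l s. 0 < l \<longrightarrow> 0 \<le> s \<longrightarrow> eproj \<rho> l ** eproj (r i) s \<noteq> 0 \<longrightarrow> c / 2 \<le> s"
      using close by (rule eventually_mono) (use gap in blast)
    show "\<forall>\<^sub>F i in sequentially. mat_image \<rho> \<subseteq> mat_image (r i)"
      using close
    proof eventually_elim
      case (elim i)
      show ?case
        unfolding image_subset_iff_kernel[OF h hr]
      proof (intro allI impI)
        fix x assume "r i *v x = 0"
        then have "x \<in> eigenspace (r i) 0" by (simp add: mem_eigenspace)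
        then have x: "eproj (r i) 0 *v x = x" by (rule eproj_fix)
        have "\<rho> *v x = (\<Sum>l\<in>real_spectrum \<rho>. l *\<^sub>R (eproj \<rho> l *v x))"
          by (subst spectral_decomposition[OF h]) (simp add: mv.sum_left mv.scaleR_left)
        also have "\<dots> = 0"
        proof (rule sum.neutral, rule ballI)
          fix l assume "l \<in> real_spectrum \<rho>"
          then have "0 \<le> l" using psd_spectrum_nonneg stateD(2)[OF \<rho>] by blast
          moreover have "eproj \<rho> l ** eproj (r i) 0 = 0" if "0 < l"
            using gap[OF elim that, of 0] c by fastforce
          ultimately show "l *\<^sub>R (eproj \<rho> l *v x) = 0"
            by (cases "l = 0") (use x in \<open>auto simp: less_le\<close>, metis x matrix_vector_mul_assoc matrix_vector_mult_0)
        qed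
        finally show "\<rho> *v x = 0" .
      qed
    qed
  qed
  then show ?thesis
    using r \<rho> by (simp add: C_rI_def entropy_conv_def entropy_rI_def)
qed


section \<open>Topologies from convergences\<close>

lemma openin_conv_topology_mono:
  "C \<subseteq> D \<Longrightarrow> openin (conv_topology S D) U \<Longrightarrow> openin (conv_topology S C) U"
  unfolding openin_conv_topology by blast

text \<open>Metric spaces are sequential: a point of \<open>U\<close> without a relative ball inside
  \<open>U\<close> would be a limit of points of \<open>S\<close> outside \<open>U\<close>, taken at
  distance below \<open>1 / (n + 1)\<close>.\<close>

lemma conv_topology_norm_conv:
  fixes S :: "'a::metric_space set"
  shows "conv_topology S (norm_conv S) = top_of_set S"
proof (rule topology_eq[THEN iffD2], rule allI, rule iffI)
  fix U assume U: "openin (conv_topology S (norm_conv S)) U"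
  then have sub: "U \<subseteq> S" by (simp add: openin_conv_topology)
  have "\<exists>e>0. \<forall>y\<in>S. dist y x < e \<longrightarrow> y \<in> U" if x: "x \<in> U" for x
  proof (rule ccontr)
    assume "\<not> ?thesis"
    then have neg: "\<exists>y. y \<in> S \<and> dist y x < e \<and> y \<notin> U" if "0 < e" for e
      using that by blast
    have "\<exists>y. y \<in> S \<and> dist y x < inverse (real (Suc n)) \<and> y \<notin> U" for n
      by (rule neg) simp
    then obtain r where r: "\<And>n. r n \<in> S" "\<And>n. dist (r n) x < inverse (real (Suc n))" "\<And>n. r n \<notin> U"
      by metis
    have "dist (r n) x \<le> dist (inverse (real (Suc n))) 0" for n
      using r(2)[of n] by simp
    then have "r \<longlonglongrightarrow> x"
      by (intro metric_tendsto_imp_tendsto[OF LIMSEQ_inverse_real_of_nat] always_eventually allI)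
    then have "(r, x) \<in> norm_conv S" using r(1) x sub by (auto simp: norm_conv_def)
    then have "\<forall>\<^sub>F i in sequentially. r i \<in> U" using U x by (auto simp: openin_conv_topology)
    then show False using r(3) by simp
  qed
  then show "openin (top_of_set S) U"
    using sub by (simp add: openin_euclidean_subtopology_iff)
next
  fix U assume "openin (top_of_set S) U"
  then obtain T where T: "open T" "U = S \<inter> T" by (auto simp: openin_open)
  have "\<forall>\<^sub>F i in sequentially. r i \<in> U" if "x \<in> U" "(r, x) \<in> norm_conv S" for r x
  proof -
    have "\<forall>\<^sub>F i in sequentially. r i \<in> T"
      using that T by (intro topological_tendstoD[of r x]) (auto simp: norm_conv_def)
    then show ?thesis
      by (rule eventually_mono) (use that(2) T(2) in \<open>simp add: norm_conv_def\<close>)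
  qed
  then show "openin (conv_topology S (norm_conv S)) U"
    using T(2) by (simp add: openin_conv_topology)
qed

text \<open>A basic set between \<open>x i\<close> and \<open>U i\<close> determines
  \<open>i\<close>, so a separated family is no larger than the basis. This refutes second
  countability for uncountable families and also bounds the number of commuting projections.\<close>

lemma countable_if_second_countable:
  assumes X: "second_countable X"
    and U: "\<And>i. i \<in> I \<Longrightarrow> openin X (U i)" "\<And>i. i \<in> I \<Longrightarrow> x i \<in> U i"
    and sep: "\<And>i j. i \<in> I \<Longrightarrow> j \<in> I \<Longrightarrow> x j \<in> U i \<Longrightarrow> i = j"
  shows "countable I"
proof -
  obtain B where B: "countable B"
    and basis: "\<forall>V y. openin X V \<and> y \<in> V \<longrightarrow> (\<exists>W\<in>B. y \<in> W \<and> W \<subseteq> V)"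
    using X unfolding second_countable_def by (elim exE conjE) (rule that)
  have "\<exists>W. W \<in> B \<and> x i \<in> W \<and> W \<subseteq> U i" if "i \<in> I" for i
    using basis[rule_format, OF conjI, OF U[OF that]] by blast
  then obtain W where W: "\<And>i. i \<in> I \<Longrightarrow> W i \<in> B \<and> x i \<in> W i \<and> W i \<subseteq> U i"
    by metis
  have "inj_on W I"
  proof (rule inj_onI)
    fix i j assume ij: "i \<in> I" "j \<in> I" "W i = W j"
    then have "x j \<in> U i" using W[of i] W[of j] by auto
    then show "i = j" by (rule sep[OF ij(1,2)])
  qed
  moreover have "W ` I \<subseteq> B" using W by blast
  ultimately show ?thesis using B
    by (intro countable_image_inj_on[of W I] countable_subset[of "W ` I" B])
qed

lemma second_countable_top_of_set:
  fixes S :: "'a::second_countable_topology set"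
  shows "second_countable (top_of_set S)"
proof (rule second_countable_subtopology)
  obtain B :: "'a set set" where B: "countable B" "topological_basis B"
    using ex_countable_basis by blast
  then show "second_countable (euclidean :: 'a topology)"
    unfolding second_countable_def
    by (intro exI[of _ B] conjI ballI allI impI)
      (use topological_basis_open[of B] topological_basisE[of B] in \<open>simp_all, metis\<close>)
qed

text \<open>I-convergent sequences eventually have the image of their limit, so any condition on the
  image alone defines an open set.\<close>

lemma openin_T_I_face:
  "openin (T_I A) {\<sigma> \<in> state_space A. mat_image \<sigma> \<subseteq> W}"
  unfolding T_I_def openin_conv_topology
  by (auto simp: C_I_iff elim!: eventually_mono)

lemma compact_space_finite_index_cover:
  assumes "topspace X \<subseteq> \<Union>(range V)" "\<And>i. openin X (V i)" "compact_space X"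
  obtains K where "finite K" "topspace X \<subseteq> \<Union>(V ` K)"
proof -
  have "\<exists>F. finite F \<and> F \<subseteq> range V \<and> topspace X \<subseteq> \<Union>F"
    using assms(3)[unfolded compact_space_alt] assms(1,2) by (elim allE[of _ "range V"]) auto
  then show thesis using that by (metis finite_subset_image)
qed

section \<open>States of a C*-subalgebra\<close>

text \<open>For \<open>a\<close> nonzero this is a state supported on the image of \<open>a\<close>;
  the divisor is the trace of \<open>a ** conj_transpose a\<close>. At \<open>a = 0\<close> the
  value is 0.\<close>

definition normalized_state :: "complex^'n^'n \<Rightarrow> complex^'n^'n" where
  "normalized_state a = inverse ((norm a)\<^sup>2) *\<^sub>R (a ** conj_transpose a)"

lemma inner_mult_conj_transpose:
  "inner x ((a ** conj_transpose a) *v x) = (norm (conj_transpose a *v x))\<^sup>2"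
  for a :: "complex^'n^'n"
  unfolding power2_norm_eq_inner
  by (metis conj_transpose_conj_transpose inner_commute inner_matrix_vector matrix_vector_mul_assoc)

lemma trace_mult_conj_transpose:
  "trace (a ** conj_transpose a) = of_real ((norm a)\<^sup>2)" for a :: "complex^'n^'n"
proof -
  have "trace (a ** conj_transpose a) = of_real (Re (trace (a ** conj_transpose a)))"
    by (rule hermitian_trace) (simp add: conj_transpose_mult)
  also have "trace (a ** conj_transpose a) = trace (conj_transpose a ** a)" by (rule trace_mul_sym)
  finally show ?thesis by (simp add: Re_trace_mult_self trace_mul_sym[of a])
qed

lemma trace_scaleR: "trace (r *\<^sub>R a) = r *\<^sub>R trace a" for a :: "complex^'n^'n"
  by (rule linear_scale[OF bounded_linear.linear[OF bounded_linear_trace]])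

lemma trace_cmat_scale: "trace (cmat_scale c a) = c * trace a"
  by (simp add: trace_def cmat_scale_def sum_distrib_left)

lemma trace_minus: "trace (a - b) = trace a - trace b" for a :: "complex^'n^'n"
  by (rule linear_diff[OF bounded_linear.linear[OF bounded_linear_trace]])

lemma trace_plus: "trace (a + b) = trace a + trace b" for a :: "complex^'n^'n"
  by (rule linear_add[OF bounded_linear.linear[OF bounded_linear_trace]])

lemma normalized_state_mem:
  assumes A: "cstar_subalgebra A" and a: "a \<in> A" "a \<noteq> 0"
  shows "normalized_state a \<in> state_space A"
proof -
  have "normalized_state a \<in> A"
    unfolding normalized_state_def
    by (intro subspace_mul cstar_subspace cstar_mult cstar_conj_transpose A a)
  moreover have "positive_semidefinite (normalized_state a)"
    by (simp add: positive_semidefinite_iff normalized_state_def conj_transpose_scaleR conj_transpose_mult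
        mv.scaleR_left inner_mult_conj_transpose)
  moreover have "trace (normalized_state a) = 1"
    unfolding normalized_state_def trace_scaleR trace_mult_conj_transpose of_real_def
    using a by simp
  ultimately show ?thesis by (simp add: state_space_def)
qed

lemma state_space_convex:
  assumes A: "cstar_subalgebra A" and "a \<in> state_space A" "b \<in> state_space A" "0 \<le> t" "t \<le> 1"
  shows "(1 - t) *\<^sub>R a + t *\<^sub>R b \<in> state_space A"
proof -
  have "(1 - t) *\<^sub>R a + t *\<^sub>R b \<in> A"
    using assms stateD(1) by (intro subspace_add subspace_mul cstar_subspace) auto
  moreover have "positive_semidefinite ((1 - t) *\<^sub>R a + t *\<^sub>R b)"
    using stateD(2)[OF assms(2)] stateD(2)[OF assms(3)] assms(4,5)
    by (auto simp: positive_semidefinite_iff conj_transpose_add conj_transpose_scaleR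
        mv.add_left mv.scaleR_left inner_add_right)
  moreover have "trace ((1 - t) *\<^sub>R a + t *\<^sub>R b) = 1"
    using stateD(3)[OF assms(2)] stateD(3)[OF assms(3)]
    by (simp add: trace_plus trace_scaleR scaleR_left_distrib[symmetric])
  ultimately show ?thesis by (simp add: state_space_def)
qed

text \<open>Boundedness is the purity estimate: eigenvalues in [0,1] satisfy
  \<open>l^2 <= l\<close>, so the squared norm is at most the trace.\<close>

lemma compact_state_space:
  assumes A: "cstar_subalgebra A"
  shows "compact (state_space A)"
proof -
  have "norm a \<le> 1" if a: "a \<in> state_space A" for a
  proof -
    note h = stateD(4)[OF a]
    have "(norm a)\<^sup>2 = (\<Sum>l\<in>real_spectrum a. l\<^sup>2 * (norm (eproj a l))\<^sup>2)"
      by (rule norm_eq_sum_eproj(1)[OF h])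
    also have "\<dots> \<le> (\<Sum>l\<in>real_spectrum a. l * (norm (eproj a l))\<^sup>2)"
    proof (intro sum_mono mult_right_mono)
      fix l assume l: "l \<in> real_spectrum a"
      show "l\<^sup>2 \<le> l"
        using psd_spectrum_nonneg[OF stateD(2)[OF a] l] state_eigenvalue_le_1[OF stateD(2,3)[OF a] l]
        by (simp add: power2_eq_square mult_left_le)
    qed auto
    also have "\<dots> = 1"
      using norm_eq_sum_eproj(2)[OF h] stateD(3)[OF a] by simp
    finally show ?thesis by (simp add: power_le_one_iff abs_square_le_1)
  qed
  then have "bounded (state_space A)" by (auto simp: bounded_iff)
  moreover have "closed (state_space A)"
  proof -
    have "state_space A = A \<inter> {a. conj_transpose a = a} \<inter> (\<Inter>x. {a. 0 \<le> inner x (a *v x)}) \<inter> {a. trace a = 1}"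
      by (auto simp: state_space_def positive_semidefinite_iff)
    moreover have "closed A" by (rule closed_subspace[OF cstar_subspace[OF A]])
    moreover have "closed {a :: complex^'n^'n. conj_transpose a = a}"
      by (intro closed_Collect_eq linear_continuous_on bounded_linear_conj_transpose continuous_on_id)
    moreover have "closed {a :: complex^'n^'n. trace a = 1}"
      by (intro closed_Collect_eq linear_continuous_on bounded_linear_trace continuous_on_const)
    moreover have "closed {a :: complex^'n^'n. 0 \<le> inner x (a *v x)}" for x
      by (intro closed_Collect_le continuous_on_const continuous_on_inner mv.continuous_on continuous_on_id)
    ultimately show ?thesis by (simp only:) (intro closed_Int closed_INT ballI)
  qed
  ultimately show ?thesis by (simp add: compact_eq_bounded_closed)
qed

section \<open>Algebras of dimension greater than one\<close>

text \<open>The trace is a linear functional; if it had trivial kernel on \<open>A\<close>, all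
  elements would be multiples of a single one.\<close>

lemma exists_traceless:
  assumes A: "cstar_subalgebra A" and dim: "cmat.dim A > 1"
  obtains a where "a \<in> A" "a \<noteq> 0" "trace a = 0"
proof -
  have "\<exists>a\<in>A. a \<noteq> 0 \<and> trace a = 0"
  proof (rule ccontr)
    assume neg: "\<not> ?thesis"
    have "\<exists>b. A \<subseteq> cmat.span {b}"
    proof (cases "\<exists>b\<in>A. trace b \<noteq> 0")
      case True
      then obtain b where b: "b \<in> A" "trace b \<noteq> 0" by blast
      have "a \<in> cmat.span {b}" if a: "a \<in> A" for a
      proof -
        define c where "c = trace a / trace b"
        have "a - cmat_scale c b \<in> A"
          using a b(1) cstar_cmat_scale[OF A] subspace_diff[OF cstar_subspace[OF A]] by blast
        moreover have "trace (a - cmat_scale c b) = 0"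
          using b(2) by (simp add: trace_minus trace_cmat_scale c_def)
        ultimately have "a = cmat_scale c b" using neg by auto
        then show ?thesis by (simp add: cmat.span_base cmat.span_scale)
      qed
      then show ?thesis by blast
    next
      case False
      then have "A \<subseteq> {0}" using neg by blast
      then show ?thesis using cmat.span_zero by blast
    qed
    then obtain b where "A \<subseteq> cmat.span {b}" by blast
    then have "cmat.dim A \<le> card {b}" by (rule cmat.dim_le_card) simp
    then show False using dim by simp
  qed
  then show thesis using that by blast
qed

text \<open>A nonzero traceless Hermitian element cannot have just one nonzero eigenvalue. Two
  distinct nonzero ones have orthogonal spectral projections, both in \<open>A\<close>.\<close>

lemma exists_orthogonal_projections:
  assumes A: "cstar_subalgebra A" and dim: "cmat.dim A > 1"
  obtains p q where "p \<in> A" "q \<in> A" "is_projection p" "is_projection q" "p \<noteq> 0" "q \<noteq> 0" "p ** q = 0"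
proof -
  obtain a where a: "a \<in> A" "a \<noteq> 0" "trace a = 0" using exists_traceless[OF A dim] by blast
  note sub = cstar_subspace[OF A]
  \<comment> \<open>Twice the real part and, up to sign, twice the imaginary part of
    \<open>a\<close>; if the latter is 0, then \<open>a\<close> is Hermitian and the former is
    \<open>2 *R a\<close>.\<close>
  let ?x = "a + conj_transpose a" and ?y = "cmat_scale \<i> (a - conj_transpose a)"
  have tr_ct: "trace (conj_transpose a) = 0"
    using arg_cong[OF a(3), of cnj] by (simp add: trace_def)
  have mem: "?x \<in> A" "?y \<in> A"
    by (intro cstar_cmat_scale[OF A] subspace_add[OF sub] subspace_diff[OF sub] cstar_conj_transpose[OF A] a(1))+
  have herm: "conj_transpose ?x = ?x" "conj_transpose ?y = ?y"
    by (simp_all add: conj_transpose_add conj_transpose_cmat_scale conj_transpose_diff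
        cmat.scale_right_diff_distrib)
  have tr: "trace ?x = 0" "trace ?y = 0"
    using a(3) tr_ct by (simp_all add: trace_plus trace_cmat_scale trace_minus)
  have "?x \<noteq> 0" if "?y = 0"
  proof -
    have "a = conj_transpose a" using that by simp
    then have "?x = 2 *\<^sub>R a" by (simp add: scaleR_2)
    then show ?thesis using a(2) by simp
  qed
  then obtain x where x: "x \<in> A" "conj_transpose x = x" "trace x = 0" "x \<noteq> 0"
    using mem herm tr by (cases "?y = 0") blast+
  note fin = finite_real_spectrum[OF x(2)]
  have tr: "(\<Sum>l\<in>real_spectrum x. l * (norm (eproj x l))\<^sup>2) = 0"
    using norm_eq_sum_eproj(2)[OF x(2)] x(3) by simp
  have "\<exists>l\<in>real_spectrum x. l \<noteq> 0"
  proof (rule ccontr)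
    assume "\<not> ?thesis"
    then have "(\<Sum>l\<in>real_spectrum x. l *\<^sub>R eproj x l) = 0" by (intro sum.neutral) auto
    then show False using x(4) spectral_decomposition[OF x(2)] by simp
  qed
  then obtain l where l: "l \<in> real_spectrum x" "l \<noteq> 0" by blast
  have "\<exists>m\<in>real_spectrum x. m \<noteq> 0 \<and> m \<noteq> l"
  proof (rule ccontr)
    assume neg: "\<not> ?thesis"
    have "(\<Sum>m\<in>real_spectrum x. m * (norm (eproj x m))\<^sup>2) = l * (norm (eproj x l))\<^sup>2"
      using fin l neg by (subst sum.remove[of _ l]) (auto intro!: sum.neutral)
    then have "eproj x l = 0" using tr l(2) by simp
    then show False using l(1) by (simp add: eproj_eq_0_iff)
  qed
  then obtain m where m: "m \<in> real_spectrum x" "m \<noteq> 0" "m \<noteq> l" by blast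
  show thesis
  proof (rule that[of "eproj x l" "eproj x m"])
    show "eproj x l \<in> A" "eproj x m \<in> A"
      using eproj_mem[OF A x(1,2)] l(2) m(2) by auto
    show "eproj x l \<noteq> 0" "eproj x m \<noteq> 0" using l(1) m(1) by (simp_all add: eproj_eq_0_iff)
    show "eproj x l ** eproj x m = 0" by (rule eproj_mult_eproj[OF x(2) m(3)[symmetric]])
  qed (rule is_projection_eproj)+
qed

text \<open>Mixing a vanishing amount of the state of \<open>q\<close> into the state of
  \<open>p\<close> enlarges the support while everything commutes, so the sequence converges in the
  rI sense but its images never reach that of the limit. The matrix \<open>q\<close> detects the
  additional support.\<close>

lemma mixing_sequence:
  fixes A :: "(complex^'n^'n) set"
  assumes A: "cstar_subalgebra A" and dim: "cmat.dim A > 1"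
  obtains p \<rho> r and q :: "complex^'n^'n" where "(r, \<rho>) \<in> C_rI A" "mat_image \<rho> \<subseteq> mat_image p"
    "q ** p = 0" "\<And>i. q ** r i \<noteq> 0"
proof -
  obtain p q where p: "p \<in> A" "is_projection p" "p \<noteq> 0" and q: "q \<in> A" "is_projection q" "q \<noteq> 0"
    and pq: "p ** q = 0"
    using exists_orthogonal_projections[OF A dim] by blast
  define \<rho> where "\<rho> = normalized_state p"
  define \<tau> where "\<tau> = normalized_state q"
  define t where "t = (\<lambda>i. inverse (real (Suc i)))"
  define r where "r = (\<lambda>i. (1 - t i) *\<^sub>R \<rho> + t i *\<^sub>R \<tau>)"
  have qp: "q ** p = 0"
    using arg_cong[OF pq, of conj_transpose] p q by (simp add: conj_transpose_mult is_projection_def)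
  have \<rho>_eq: "\<rho> = inverse ((norm p)\<^sup>2) *\<^sub>R p" and \<tau>_eq: "\<tau> = inverse ((norm q)\<^sup>2) *\<^sub>R q"
    using p q by (simp_all add: \<rho>_def \<tau>_def normalized_state_def is_projection_def)
  have S: "\<rho> \<in> state_space A" "\<tau> \<in> state_space A"
    unfolding \<rho>_def \<tau>_def using p q by (simp_all add: normalized_state_mem[OF A])
  have t: "0 < t i" "t i \<le> 1" for i by (simp_all add: t_def inverse_le_1_iff)
  have t0: "t \<longlonglongrightarrow> 0" unfolding t_def by (rule LIMSEQ_inverse_real_of_nat)
  have "(\<lambda>i. (1 - t i) *\<^sub>R \<rho> + t i *\<^sub>R \<tau>) \<longlonglongrightarrow> (1 - 0) *\<^sub>R \<rho> + 0 *\<^sub>R \<tau>"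
    by (intro tendsto_add tendsto_scaleR tendsto_diff tendsto_const t0)
  then have conv: "r \<longlonglongrightarrow> \<rho>" by (simp add: r_def)
  have rS: "r i \<in> state_space A" for i
    unfolding r_def using state_space_convex[OF A S] t[of i] by simp
  have comm: "\<rho> ** r i = r i ** \<rho>" for i
    by (simp add: r_def \<rho>_eq \<tau>_eq mm.add_left mm.add_right mm.scaleR_left mm.scaleR_right pq qp)
  show thesis
  proof (rule that[OF commuting_norm_conv_imp_C_rI[OF rS S(1) conv comm] _ qp])
    show "mat_image \<rho> \<subseteq> mat_image p"
    proof
      fix y assume "y \<in> mat_image \<rho>"
      then obtain x where "y = \<rho> *v x" unfolding mat_image_def by blast
      then have "y = p *v (inverse ((norm p)\<^sup>2) *\<^sub>R x)"
        unfolding \<rho>_eq by (simp only: mv.scaleR_left matrix_scaleR_right)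
      then show "y \<in> mat_image p" unfolding mat_image_def by (rule range_eqI)
    qed
    show "q ** r i \<noteq> 0" for i
      using t[of i] q by (simp add: r_def \<rho>_eq \<tau>_eq mm.add_right mm.scaleR_right qp is_projection_def)
  qed
qed

lemma mult_eq_0_if_image_subset:
  fixes q p a :: "complex^'n^'n"
  assumes "mat_image a \<subseteq> mat_image p" "q ** p = 0"
  shows "q ** a = 0"
proof -
  have "q *v (a *v x) = 0" for x
  proof -
    have "a *v x \<in> mat_image p" using assms(1) unfolding mat_image_def by blast
    then obtain y where "a *v x = p *v y" unfolding mat_image_def by blast
    then show ?thesis using assms(2) by (simp add: matrix_vector_mul_assoc)
  qed
  then show ?thesis by (simp add: matrix_eq_0_iff matrix_vector_mul_assoc[symmetric])
qed

text \<open>Vanishing of \<open>q ** \<sigma>\<close> depends on the image of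
  \<open>\<sigma>\<close> only, and the other alternative is open in norm.\<close>

lemma openin_T_I_gap:
  fixes q :: "complex^'n^'n"
  shows "openin (T_I A) {\<sigma> \<in> state_space A. q ** \<sigma> = 0 \<or> e < norm (q ** \<sigma>)}"
  unfolding T_I_def openin_conv_topology
proof (intro conjI allI impI)
  fix r \<rho> assume \<rho>: "\<rho> \<in> {\<sigma> \<in> state_space A. q ** \<sigma> = 0 \<or> e < norm (q ** \<sigma>)}" and "(r, \<rho>) \<in> C_I A"
  then have r: "\<And>i. r i \<in> state_space A" "r \<longlonglongrightarrow> \<rho>"
    "\<forall>\<^sub>F i in sequentially. mat_image (r i) = mat_image \<rho>"
    by (auto simp: C_I_iff)
  from \<rho> consider "q ** \<rho> = 0" | "e < norm (q ** \<rho>)" by blast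
  then show "\<forall>\<^sub>F i in sequentially. r i \<in> {\<sigma> \<in> state_space A. q ** \<sigma> = 0 \<or> e < norm (q ** \<sigma>)}"
  proof cases
    case 1
    show ?thesis
      using r(3)
    proof eventually_elim
      case (elim i)
      then have "q ** r i = 0" by (intro mult_eq_0_if_image_subset[OF _ 1]) simp
      then show ?case using r(1) by simp
    qed
  next
    case 2
    have "(\<lambda>i. norm (q ** r i)) \<longlonglongrightarrow> norm (q ** \<rho>)"
      by (intro tendsto_norm mm.tendsto tendsto_const r)
    then have "\<forall>\<^sub>F i in sequentially. e < norm (q ** r i)" using 2 by (rule order_tendstoD)
    then show ?thesis by (rule eventually_mono) (simp add: r(1))
  qed
qed blast

lemma entropy_topologies_dim_gt_1:
  fixes A :: "(complex^'n^'n) set"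
  assumes A: "cstar_subalgebra A" and dim: "cmat.dim A > 1"
  shows "C_I A \<subset> C_rI A"
    and "{U. openin (T_rI A) U} \<subset> {U. openin (T_I A) U}"
    and "\<not> compact_space (T_I A)"
proof -
  obtain p \<rho> r and q :: "complex^'n^'n" where r: "(r, \<rho>) \<in> C_rI A"
    and im: "mat_image \<rho> \<subseteq> mat_image p" and qp: "q ** p = 0" and qr: "\<And>i. q ** r i \<noteq> 0"
    by (rule mixing_sequence[OF A dim]) (rule that)
  have rS: "r i \<in> state_space A" and \<rho>S: "\<rho> \<in> state_space A" for i
    using r by (auto simp: C_rI_def entropy_conv_def)
  define U where "U = {\<sigma> \<in> state_space A. mat_image \<sigma> \<subseteq> mat_image p}"
  have openU: "openin (T_I A) U" unfolding U_def by (rule openin_T_I_face)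
  have \<rho>U: "\<rho> \<in> U" using im \<rho>S by (simp add: U_def)
  have rU: "r i \<notin> U" for i
    using qr[of i] mult_eq_0_if_image_subset[OF _ qp, of "r i"] unfolding U_def by blast
  have "(r, \<rho>) \<notin> C_I A"
  proof
    assume "(r, \<rho>) \<in> C_I A"
    then have "\<forall>\<^sub>F i in sequentially. r i \<in> U"
      using openU \<rho>U unfolding T_I_def openin_conv_topology by blast
    then show False using rU by simp
  qed
  then show "C_I A \<subset> C_rI A" using C_I_subset_C_rI r by blast
  have "\<not> openin (T_rI A) U"
  proof
    assume "openin (T_rI A) U"
    then have "\<forall>\<^sub>F i in sequentially. r i \<in> U"
      using r \<rho>U unfolding T_rI_def openin_conv_topology by blast
    then show False using rU by simp
  qed
  moreover have "openin (T_I A) V" if "openin (T_rI A) V" for V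
    using that unfolding T_I_def T_rI_def by (rule openin_conv_topology_mono[OF C_I_subset_C_rI])
  ultimately show "{U. openin (T_rI A) U} \<subset> {U. openin (T_I A) U}"
    using openU by blast
  show "\<not> compact_space (T_I A)"
  proof
    assume "compact_space (T_I A)"
    \<comment> \<open>Each set admits the value 0 of \<open>norm (q ** \<sigma>)\<close> but
      excludes small nonzero ones. Along \<open>r\<close> the values are nonzero and tend to 0, so
      finitely many of the sets cannot contain the sequence.\<close>
    define V where "V = (\<lambda>k::nat. {\<sigma> \<in> state_space A. q ** \<sigma> = 0 \<or> inverse (real (Suc k)) < norm (q ** \<sigma>)})"
    have "\<exists>k. \<sigma> \<in> V k" if "\<sigma> \<in> state_space A" for \<sigma>
      using that reals_Archimedean[of "norm (q ** \<sigma>)"] by (cases "q ** \<sigma> = 0") (auto simp: V_def)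
    then have "topspace (T_I A) \<subseteq> \<Union>(range V)" by auto
    moreover have "openin (T_I A) (V k)" for k
      unfolding V_def by (rule openin_T_I_gap)
    ultimately obtain K where K: "finite K" "topspace (T_I A) \<subseteq> \<Union>(V ` K)"
      using \<open>compact_space (T_I A)\<close> by (rule compact_space_finite_index_cover)
    \<comment> \<open>Inserting 0 keeps the maximum defined for empty \<open>K\<close>.\<close>
    define m where "m = Max (insert 0 K)"
    have ge: "inverse (real (Suc m)) < norm (q ** r i)" for i
    proof -
      have "r i \<in> \<Union>(V ` K)" using K(2) rS[of i] by auto
      then obtain k where k: "k \<in> K" "inverse (real (Suc k)) < norm (q ** r i)"
        using qr[of i] by (auto simp: V_def)
      have "k \<le> m" using K(1) k(1) by (simp add: m_def)
      then have "inverse (real (Suc m)) \<le> inverse (real (Suc k))" by (simp add: le_imp_inverse_le)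
      then show ?thesis using k(2) by linarith
    qed
    have "(\<lambda>i. norm (q ** r i)) \<longlonglongrightarrow> norm (q ** \<rho>)"
      by (intro tendsto_norm mm.tendsto tendsto_const C_rI_imp_norm(1)[OF r])
    also have "q ** \<rho> = 0" by (rule mult_eq_0_if_image_subset[OF im qp])
    finally have "\<forall>\<^sub>F i in sequentially. norm (q ** r i) < inverse (real (Suc m))"
      by (intro order_tendstoD) auto
    then obtain i where "norm (q ** r i) < inverse (real (Suc m))"
      by (auto dest: eventually_happens)
    with ge[of i] show False by simp
  qed
qed


section \<open>Noncommutative algebras\<close>

text \<open>Real and imaginary parts reduce one factor to Hermitian elements; the reduction is
  applied to each factor in turn.\<close>

lemma commutative_if_hermitian_commute:
  assumes A: "cstar_subalgebra A"
    and comm: "\<And>a b. a \<in> A \<Longrightarrow> b \<in> A \<Longrightarrow> conj_transpose a = a \<Longrightarrow> conj_transpose b = b \<Longrightarrow> a ** b = b ** a"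
  shows "commutative_algebra A"
proof -
  note sub = cstar_subspace[OF A]
  have step: "a ** b = b ** a"
    if P: "\<And>h. h \<in> A \<Longrightarrow> conj_transpose h = h \<Longrightarrow> h ** b = b ** h" and a: "a \<in> A" for a b
  proof -
    let ?x = "a + conj_transpose a" and ?y = "cmat_scale \<i> (a - conj_transpose a)"
    have "?x \<in> A" "?y \<in> A"
      by (intro cstar_cmat_scale[OF A] subspace_add[OF sub] subspace_diff[OF sub] cstar_conj_transpose[OF A] a)+
    then have x: "?x ** b = b ** ?x" and y: "?y ** b = b ** ?y"
      by (auto intro!: P simp: conj_transpose_add conj_transpose_cmat_scale conj_transpose_diff
          cmat.scale_right_diff_distrib)
    have "?y ** b = cmat_scale \<i> ((a - conj_transpose a) ** b)"
      by (simp add: vec_eq_iff cmat_scale_def matrix_mult_entry sum_distrib_left mult_ac)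
    moreover have "b ** ?y = cmat_scale \<i> (b ** (a - conj_transpose a))"
      by (simp add: vec_eq_iff cmat_scale_def matrix_mult_entry sum_distrib_left mult_ac)
    ultimately have "(a - conj_transpose a) ** b = b ** (a - conj_transpose a)"
      using y by simp
    with x have "(a - conj_transpose a) ** b + ?x ** b = b ** (a - conj_transpose a) + b ** ?x"
      by simp
    then have "(2 *\<^sub>R a) ** b = b ** (2 *\<^sub>R a)"
      by (simp add: mm.add_left[symmetric] mm.add_right[symmetric] scaleR_2)
    then show ?thesis by (simp add: mm.scaleR_left mm.scaleR_right)
  qed
  have "h ** b = b ** h" if "h \<in> A" "conj_transpose h = h" "b \<in> A" for h b
    using step[of h b] comm that by metis
  then show ?thesis
    unfolding commutative_algebra_def using step by blast
qed

text \<open>Only nonzero eigenvalues contribute to the spectral sum of \<open>a\<close>, so one of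
  their projections must fail to commute with \<open>b\<close>, and such a projection lies in
  \<open>A\<close>.\<close>

lemma noncommuting_projection:
  assumes A: "cstar_subalgebra A" and nc: "\<not> commutative_algebra A"
  obtains p b where "p \<in> A" "is_projection p" "b \<in> A" "conj_transpose b = b" "p ** b \<noteq> b ** p"
proof -
  obtain a b where ab: "a \<in> A" "b \<in> A" "conj_transpose a = a" "conj_transpose b = b" "a ** b \<noteq> b ** a"
    using commutative_if_hermitian_commute[OF A] nc by blast
  have "\<exists>l. l \<noteq> 0 \<and> eproj a l ** b \<noteq> b ** eproj a l"
  proof (rule ccontr)
    assume "\<not> ?thesis"
    then have eq: "l *\<^sub>R (eproj a l ** b) = l *\<^sub>R (b ** eproj a l)" for l by (cases "l = 0") auto
    have "a ** b = (\<Sum>l\<in>real_spectrum a. l *\<^sub>R (eproj a l ** b))"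
      by (subst spectral_decomposition[OF ab(3)]) (simp only: mm.sum_left mm.scaleR_left)
    also have "\<dots> = (\<Sum>l\<in>real_spectrum a. b ** (l *\<^sub>R eproj a l))"
      by (simp only: eq mm.scaleR_right)
    also have "\<dots> = b ** a"
      by (subst (2) spectral_decomposition[OF ab(3)]) (simp only: mm.sum_right)
    finally show False using ab(5) by simp
  qed
  then obtain l where "l \<noteq> 0" "eproj a l ** b \<noteq> b ** eproj a l" by blast
  then show thesis
    using that[of "eproj a l" b] eproj_mem[OF A ab(1,3)] is_projection_eproj ab(2,4) by blast
qed

lemma normalized_state_kernel:
  "normalized_state a *v x = 0 \<longleftrightarrow> conj_transpose a *v x = 0" for a :: "complex^'n^'n"
proof (cases "a = 0")
  case False
  have "normalized_state a *v x = 0 \<longleftrightarrow> (a ** conj_transpose a) *v x = 0"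
    using False by (simp add: normalized_state_def mv.scaleR_left)
  also have "\<dots> \<longleftrightarrow> conj_transpose a *v x = 0"
  proof
    assume "(a ** conj_transpose a) *v x = 0"
    then show "conj_transpose a *v x = 0"
      using inner_mult_conj_transpose[of x a] by simp
  qed (simp add: matrix_vector_mul_assoc[symmetric])
  finally show ?thesis .
qed (simp add: normalized_state_def)

text \<open>The range of \<open>p + t x\<close> with \<open>x = b p - p b p\<close> is the graph over the range of \<open>p\<close> of
  \<open>t x\<close>, so the states supported on these ranges are pairwise incomparable although they
  depend continuously on \<open>t\<close>.\<close>

lemma incomparable_states:
  fixes A :: "(complex^'n^'n) set"
  assumes A: "cstar_subalgebra A" and nc: "\<not> commutative_algebra A"
  obtains \<rho> :: "real \<Rightarrow> complex^'n^'n" where "\<And>t. \<rho> t \<in> state_space A" "continuous_on UNIV \<rho>"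
    "\<And>s t. mat_image (\<rho> t) \<subseteq> mat_image (\<rho> s) \<Longrightarrow> t = s"
proof -
  obtain p b where p: "p \<in> A" "is_projection p" and b: "b \<in> A" "conj_transpose b = b"
    and pb: "p ** b \<noteq> b ** p"
    using noncommuting_projection[OF A nc] by blast
  have pp: "p ** p = p" "conj_transpose p = p" using p(2) by (simp_all add: is_projection_def)
  note sub = cstar_subspace[OF A]
  define x where "x = b ** p - p ** b ** p"
  define a where "a = (\<lambda>t. p + t *\<^sub>R x)"
  have x: "p ** x = 0" "x ** p = x"
    by (simp_all add: x_def mm.diff_right mm.diff_left matrix_mul_assoc pp(1))
      (simp_all add: matrix_mul_assoc[symmetric] pp(1))
  \<comment> \<open>Otherwise \<open>b ** p\<close> would equal the Hermitian matrix
    \<open>p ** b ** p\<close>, and its adjoint \<open>p ** b\<close> would be the same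
    matrix.\<close>
  have "x \<noteq> 0"
  proof
    assume "x = 0"
    then have eq: "b ** p = p ** b ** p" by (simp add: x_def)
    have "p ** b = conj_transpose (b ** p)" by (simp add: conj_transpose_mult pp b)
    also have "\<dots> = conj_transpose (p ** b ** p)" by (simp only: eq)
    also have "\<dots> = p ** b ** p" by (simp add: conj_transpose_mult matrix_mul_assoc pp b)
    finally show False using pb eq by simp
  qed
  have xA: "x \<in> A" unfolding x_def by (intro subspace_diff[OF sub] cstar_mult[OF A] p b)
  have "p \<noteq> 0" using \<open>x \<noteq> 0\<close> x(2) by auto
  have a_ne: "a t \<noteq> 0" for t
  proof
    assume "a t = 0"
    then have "p ** a t = 0" by simp
    then show False using \<open>p \<noteq> 0\<close> by (simp add: a_def mm.add_right mm.scaleR_right x pp)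
  qed
  have aA: "a t \<in> A" for t
    unfolding a_def by (intro subspace_add[OF sub] subspace_mul[OF sub] p xA)
  show thesis
  proof
    show "normalized_state (a t) \<in> state_space A" for t
      by (rule normalized_state_mem[OF A aA a_ne])
    have ca: "continuous_on UNIV a" unfolding a_def by (intro continuous_intros)
    then show "continuous_on UNIV (\<lambda>t. normalized_state (a t))"
      unfolding normalized_state_def using a_ne
      by (intro continuous_on_scaleR continuous_on_inverse continuous_on_power continuous_on_norm
          mm.continuous_on bounded_linear.continuous_on[OF bounded_linear_conj_transpose]) auto
    fix s t assume im: "mat_image (normalized_state (a t)) \<subseteq> mat_image (normalized_state (a s))"
    define y where "y = conj_transpose x"
    have y: "y ** p = 0" "p ** y = y"
      using arg_cong[OF x(1), of conj_transpose] arg_cong[OF x(2), of conj_transpose] pp(2)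
      by (simp_all add: y_def conj_transpose_mult)
    have yy: "y ** y = 0" by (metis y matrix_mul_assoc mm.zero_left)
    have at: "conj_transpose (a u) = p + u *\<^sub>R y" for u
      by (simp add: a_def y_def conj_transpose_add conj_transpose_scaleR pp)
    \<comment> \<open>Chosen so that \<open>conj_transpose (a s)\<close> annihilates it; multiplied
      by \<open>conj_transpose (a t)\<close> from the left, it exposes the difference
      \<open>t - s\<close> as the coefficient of \<open>y\<close>.\<close>
    define B where "B = mat 1 - p - s *\<^sub>R y"
    have aB: "conj_transpose (a u) ** B = (u - s) *\<^sub>R y" for u
      by (simp add: at B_def mm.add_left mm.diff_right mm.scaleR_left mm.scaleR_right y yy pp
          scaleR_left_diff_distrib)
    have "conj_transpose (a s) *v (B *v v) = 0" for v
      by (simp add: matrix_vector_mul_assoc aB)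
    moreover have "conj_transpose (normalized_state (a u)) = normalized_state (a u)" for u
      using stateD(4)[OF normalized_state_mem[OF A aA a_ne]] .
    ultimately have "conj_transpose (a t) *v (B *v v) = 0" for v
      using im by (simp add: image_subset_iff_kernel normalized_state_kernel)
    then have "conj_transpose (a t) ** B = 0"
      by (simp add: matrix_eq_0_iff matrix_vector_mul_assoc)
    then have "t = s \<or> y = 0" by (simp add: aB)
    moreover have "y \<noteq> 0"
      using \<open>x \<noteq> 0\<close> by (metis y_def conj_transpose_conj_transpose conj_transpose_zero)
    ultimately show "t = s" by simp
  qed
qed

lemma noncommutative_entropy_topologies:
  fixes A :: "(complex^'n^'n) set"
  assumes A: "cstar_subalgebra A" and nc: "\<not> commutative_algebra A"
  shows "\<not> second_countable (T_I A)" and "\<not> second_countable (T_rI A)"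
    and "\<not> compact_space (T_rI A)"
proof -
  obtain \<rho> :: "real \<Rightarrow> complex^'n^'n" where \<rho>: "\<And>t. \<rho> t \<in> state_space A" "continuous_on UNIV \<rho>"
    and inc: "\<And>s t. mat_image (\<rho> t) \<subseteq> mat_image (\<rho> s) \<Longrightarrow> t = s"
    by (rule incomparable_states[OF A nc]) (rule that)
  show "\<not> second_countable (T_I A)"
  proof
    assume sc: "second_countable (T_I A)"
    \<comment> \<open>The faces of the curve points are open and, by incomparability, each contains
      only one point of the curve.\<close>
    have "countable (UNIV :: real set)"
      by (rule countable_if_second_countable[OF sc openin_T_I_face, where x = \<rho> and W1 = "\<lambda>t. mat_image (\<rho> t)"])
        (use \<rho>(1) inc in auto)
    then show False using uncountable_UNIV_real by blast
  qed
  \<comment> \<open>\<open>U t\<close> removes every point of the arc except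
    \<open>\<rho> t\<close>. It is open because rI-convergence to \<open>\<rho> t\<close> forces
    images containing that of \<open>\<rho> t\<close>, which no other point of the curve has; at
    limits off the arc, norm-closedness of the compact arc suffices.\<close>
  define U where "U = (\<lambda>t. state_space A - \<rho> ` ({0..1} - {t}))"
  have compact_curve: "compact (\<rho> ` {0..1})"
    by (intro compact_continuous_image continuous_on_subset[OF \<rho>(2)]) auto
  have openU: "openin (T_rI A) (U t)" for t
    unfolding T_rI_def openin_conv_topology
  proof (intro conjI allI impI)
    show "U t \<subseteq> state_space A" by (auto simp: U_def)
    fix r \<sigma> assume \<sigma>: "\<sigma> \<in> U t" and r: "(r, \<sigma>) \<in> C_rI A"
    have rS: "r i \<in> state_space A" for i using r by (auto simp: C_rI_def entropy_conv_def)
    show "\<forall>\<^sub>F i in sequentially. r i \<in> U t"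
    proof (cases "\<sigma> \<in> \<rho> ` {0..1}")
      case True
      then obtain s where s: "\<sigma> = \<rho> s" "s \<in> {0..1}" by blast
      then have "s = t" using \<sigma> by (auto simp: U_def)
      show ?thesis
        using C_rI_imp_norm(2)[OF r]
      proof eventually_elim
        case (elim i)
        then have "r i \<noteq> \<rho> u" if "u \<noteq> t" for u
          using inc[of t u] that s(1) \<open>s = t\<close> by auto
        then show ?case using rS[of i] by (auto simp: U_def)
      qed
    next
      case False
      have "open (- (\<rho> ` {0..1}))" using compact_imp_closed[OF compact_curve] by (rule open_Compl)
      then have "\<forall>\<^sub>F i in sequentially. r i \<in> - (\<rho> ` {0..1})"
        using False by (intro topological_tendstoD[OF C_rI_imp_norm(1)[OF r]]) auto
      then show ?thesis
      proof eventually_elim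
        case (elim i)
        then show ?case using rS[of i] by (auto simp: U_def)
      qed
    qed
  qed
  have inj: "\<rho> s = \<rho> t \<Longrightarrow> s = t" for s t using inc[of s t] by simp
  have memU: "\<rho> t \<in> U t" for t
    using \<rho>(1) inj[of t] unfolding U_def by blast
  have sep: "t = s" if "s \<in> {0..1}" "\<rho> s \<in> U t" for s t
    using that unfolding U_def by blast
  show "\<not> second_countable (T_rI A)"
  proof
    assume sc: "second_countable (T_rI A)"
    have "countable {0..1::real}"
      by (rule countable_if_second_countable[OF sc openU memU sep])
    then show False using uncountable_closed_interval[of 0 "1::real"] by simp
  qed
  show "\<not> compact_space (T_rI A)"
  proof
    assume c: "compact_space (T_rI A)"
    have "\<sigma> \<in> \<Union>(range U)" if "\<sigma> \<in> state_space A" for \<sigma>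
    proof (cases "\<sigma> \<in> \<rho> ` {0..1}")
      case True
      then show ?thesis using memU by blast
    next
      case False
      then have "\<sigma> \<in> U 0" using that unfolding U_def by blast
      then show ?thesis by blast
    qed
    then have "topspace (T_rI A) \<subseteq> \<Union>(range U)" by auto
    then obtain K where K: "finite K" "topspace (T_rI A) \<subseteq> \<Union>(U ` K)"
      using openU c by (rule compact_space_finite_index_cover)
    \<comment> \<open>Every index in the interval is needed, since \<open>U s\<close> is the only
      set of the cover that contains \<open>\<rho> s\<close>.\<close>
    have "{0..1} \<subseteq> K"
    proof
      fix s :: real assume s: "s \<in> {0..1}"
      have "\<rho> s \<in> \<Union>(U ` K)" using K(2) \<rho>(1)[of s] by auto
      then obtain t where "t \<in> K" "\<rho> s \<in> U t" by blast
      then show "s \<in> K" using sep[OF s] by blast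
    qed
    then have "finite {0..1::real}" using K(1) finite_subset by blast
    then show False by (simp add: infinite_Icc)
  qed
qed

section \<open>Commutative algebras\<close>

text \<open>For commuting projections the difference \<open>e\<close> satisfies
  \<open>e ** (e ** e) = e\<close>, so \<open>e ** e\<close> fixes the range of \<open>e\<close>;
  unless that range is zero, the norm of \<open>e\<close> is at least 1.\<close>

lemma commuting_projections_dist:
  fixes p q :: "complex^'n^'n"
  assumes p: "is_projection p" and q: "is_projection q" and comm: "p ** q = q ** p" and d: "dist p q < 1"
  shows "p = q"
proof (rule ccontr)
  assume "p \<noteq> q"
  define e where "e = p - q"
  obtain x where x: "e *v x \<noteq> 0" using \<open>p \<noteq> q\<close> matrix_eq_0_iff[of e] by (auto simp: e_def)
  have pp: "p ** p = p" "q ** q = q" using p q by (simp_all add: is_projection_def)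
  have ppq: "p ** (p ** q) = p ** q" "q ** (p ** q) = p ** q"
    by (metis matrix_mul_assoc pp(1), metis comm matrix_mul_assoc pp(2))
  have "e ** e = p + q - 2 *\<^sub>R (p ** q)"
    by (simp add: e_def mm.diff_left mm.diff_right pp comm[symmetric] scaleR_2)
  then have "e ** (e ** e) = e ** p + e ** q - 2 *\<^sub>R (e ** (p ** q))"
    by (simp add: mm.diff_right mm.add_right mm.scaleR_right)
  also have "\<dots> = e"
    by (simp add: e_def mm.diff_left pp ppq comm[symmetric])
  finally have cube: "e ** (e ** e) = e" .
  have "e *v (e *v (e *v x)) = (e ** (e ** e)) *v x" by (simp only: matrix_vector_mul_assoc)
  then have "norm (e *v x) = norm (e *v (e *v (e *v x)))" by (simp only: cube)
  also have "\<dots> \<le> norm e * norm (e *v (e *v x))" by (rule norm_matrix_vector_le)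
  also have "\<dots> \<le> norm e * (norm e * norm (e *v x))"
    by (intro mult_left_mono norm_matrix_vector_le norm_ge_zero)
  finally have "1 \<le> norm e * norm e" using x by (simp add: mult.assoc[symmetric])
  moreover have "norm e < 1" using d by (simp add: e_def dist_norm)
  moreover from this have "norm e * norm e \<le> norm e * 1" by (intro mult_left_mono) auto
  ultimately show False by simp
qed

text \<open>The complement of the kernel projection is the sum of the spectral projections for
  nonzero eigenvalues, hence lies in \<open>A\<close> even if the identity does not.\<close>

lemma support_projection:
  assumes A: "cstar_subalgebra A" and a: "a \<in> A" "conj_transpose a = a"
  obtains e where "e \<in> A" "is_projection e" "mat_image e = mat_image a"
proof
  define e where "e = mat 1 - eproj a 0"
  have "e = (\<Sum>l\<in>real_spectrum a - {0}. eproj a l)"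
  proof (cases "0 \<in> real_spectrum a")
    case True
    then show ?thesis
      using sum.remove[OF finite_real_spectrum[OF a(2)] True, of "eproj a"] sum_eproj[OF a(2)]
      by (simp add: e_def)
  next
    case False
    then show ?thesis using sum_eproj[OF a(2)] by (simp add: e_def eproj_eq_0_iff[THEN iffD2])
  qed
  then show "mat 1 - eproj a 0 \<in> A"
    unfolding e_def[symmetric]
    by (auto intro!: subspace_sum cstar_subspace[OF A] eproj_mem[OF A a])
  have h: "conj_transpose (mat 1 - eproj a 0) = mat 1 - eproj a 0"
    by (simp add: conj_transpose_diff)
  then show "is_projection (mat 1 - eproj a 0)"
    by (simp add: is_projection_def mm.diff_left mm.diff_right)
  have ker: "(mat 1 - eproj a 0) *v x = 0 \<longleftrightarrow> a *v x = 0" for x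
  proof -
    have "(mat 1 - eproj a 0) *v x = 0 \<longleftrightarrow> eproj a 0 *v x = x"
      by (auto simp: mv.diff_left)
    also have "\<dots> \<longleftrightarrow> x \<in> eigenspace a 0"
      using eproj_in_eigenspace[of a 0 x] eproj_fix[of x a 0] by auto
    finally show ?thesis by (simp add: mem_eigenspace)
  qed
  show "mat_image (mat 1 - eproj a 0) = mat_image a"
    by (intro antisym) (simp_all add: image_subset_iff_kernel[OF h a(2)] image_subset_iff_kernel[OF a(2) h] ker)
qed

text \<open>Distinct commuting projections are at distance at least 1, so unit balls separate them
  in a second countable space; every support is the image of one of them.\<close>

lemma countable_supports:
  fixes A :: "(complex^'n^'n) set"
  assumes A: "cstar_subalgebra A" and comm: "commutative_algebra A"
  shows "countable (mat_image ` state_space A)"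
proof -
  let ?E = "{e \<in> A. is_projection e}"
  have sc: "second_countable (euclidean :: (complex^'n^'n) topology)"
    using second_countable_top_of_set[of "UNIV :: (complex^'n^'n) set"] by simp
  have "countable ?E"
  proof (rule countable_if_second_countable[OF sc])
    show "openin euclidean (ball e 1)" for e :: "complex^'n^'n" by simp
    show "e \<in> ball e 1" for e :: "complex^'n^'n" by simp
    show "e = f" if "e \<in> ?E" "f \<in> ?E" "f \<in> ball e 1" for e f
    proof (rule commuting_projections_dist)
      show "e ** f = f ** e" using that(1,2) comm unfolding commutative_algebra_def by blast
    qed (use that in simp_all)
  qed
  moreover have "mat_image ` state_space A \<subseteq> mat_image ` ?E"
  proof
    fix W assume "W \<in> mat_image ` state_space A"
    then obtain a where a: "a \<in> state_space A" "W = mat_image a" by blast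
    obtain e where "e \<in> A" "is_projection e" "mat_image e = mat_image a"
      by (rule support_projection[OF A stateD(1,4)[OF a(1)]])
    then show "W \<in> mat_image ` ?E" using a(2) by blast
  qed
  ultimately show ?thesis by (intro countable_subset[of "mat_image ` state_space A" "mat_image ` ?E"] countable_image)
qed

lemma commutative_imp_C_rI_eq_C_norm:
  assumes "commutative_algebra A"
  shows "C_rI A = C_norm A"
proof (intro equalityI subsetI)
  fix z assume z: "z \<in> C_rI A"
  obtain r \<rho> where eq: "z = (r, \<rho>)" by (cases z)
  have "r \<longlonglongrightarrow> \<rho>" using z unfolding eq by (rule C_rI_imp_norm(1))
  then show "z \<in> C_norm A"
    using z by (simp add: eq C_norm_def norm_conv_def C_rI_def entropy_conv_def)
next
  fix z assume "z \<in> C_norm A"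
  then obtain r \<rho> where z: "z = (r, \<rho>)" "\<And>i. r i \<in> state_space A" "\<rho> \<in> state_space A" "r \<longlonglongrightarrow> \<rho>"
    by (cases z) (simp add: C_norm_def norm_conv_def)
  have "\<rho> ** r i = r i ** \<rho>" for i
    using assms stateD(1)[OF z(2)] stateD(1)[OF z(3)] by (simp add: commutative_algebra_def)
  then show "z \<in> C_rI A"
    unfolding z(1) by (rule commuting_norm_conv_imp_C_rI[OF z(2-4)])
qed

text \<open>Norm-basic sets intersected with the states of one fixed image form a basis. Only
  countably many images occur, which is where commutativity enters.\<close>

lemma commutative_imp_second_countable_T_I:
  fixes A :: "(complex^'n^'n) set"
  assumes A: "cstar_subalgebra A" and comm: "commutative_algebra A"
  shows "second_countable (T_I A)"
proof -
  obtain B :: "(complex^'n^'n) set set" where B: "countable B" "topological_basis B"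
    using ex_countable_basis by blast
  let ?F = "\<lambda>(b, W). {\<sigma> \<in> state_space A. \<sigma> \<in> b \<and> mat_image \<sigma> = W}"
  define D where "D = ?F ` (B \<times> mat_image ` state_space A)"
  have "countable D"
    unfolding D_def by (intro countable_image countable_SIGMA B countable_supports[OF A comm])
  moreover have "openin (T_I A) V" if VD: "V \<in> D" for V
  proof -
    obtain b W where V: "V = {\<sigma> \<in> state_space A. \<sigma> \<in> b \<and> mat_image \<sigma> = W}" and "b \<in> B"
      using VD by (auto simp: D_def)
    then have "open b" using B(2) topological_basis_open by blast
    have "\<forall>\<^sub>F i in sequentially. r i \<in> V" if "\<rho> \<in> V" "(r, \<rho>) \<in> C_I A" for r \<rho>
    proof -
      have r: "\<And>i. r i \<in> state_space A" "r \<longlonglongrightarrow> \<rho>" "\<forall>\<^sub>F i in sequentially. mat_image (r i) = mat_image \<rho>"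
        using that(2) by (auto simp: C_I_iff)
      have "\<forall>\<^sub>F i in sequentially. r i \<in> b"
        using that(1) V by (intro topological_tendstoD[OF r(2) \<open>open b\<close>]) auto
      with r(3) show ?thesis
        by eventually_elim (use r(1) that(1) V in auto)
    qed
    then show ?thesis unfolding T_I_def openin_conv_topology by (auto simp: V)
  qed
  moreover have "\<exists>V\<in>D. \<rho> \<in> V \<and> V \<subseteq> U" if U: "openin (T_I A) U" "\<rho> \<in> U" for U \<rho>
  proof -
    have \<rho>: "\<rho> \<in> state_space A" using U openin_subset by fastforce
    \<comment> \<open>Otherwise states outside \<open>U\<close> with the image of
      \<open>\<rho>\<close>, at distance below \<open>1 / (n + 1)\<close>, would I-converge to
      \<open>\<rho>\<close>.\<close>
    have "\<exists>e>0. \<forall>\<sigma>\<in>state_space A. mat_image \<sigma> = mat_image \<rho> \<longrightarrow> dist \<sigma> \<rho> < e \<longrightarrow> \<sigma> \<in> U"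
    proof (rule ccontr)
      assume "\<not> ?thesis"
      then have neg: "\<exists>\<sigma>. \<sigma> \<in> state_space A \<and> mat_image \<sigma> = mat_image \<rho> \<and> dist \<sigma> \<rho> < e \<and> \<sigma> \<notin> U" if "0 < e" for e
        using that by blast
      have "\<exists>\<sigma>. \<sigma> \<in> state_space A \<and> mat_image \<sigma> = mat_image \<rho> \<and> dist \<sigma> \<rho> < inverse (real (Suc n)) \<and> \<sigma> \<notin> U" for n
        by (rule neg) simp
      then obtain r where r: "\<And>n. r n \<in> state_space A" "\<And>n. mat_image (r n) = mat_image \<rho>"
        "\<And>n. dist (r n) \<rho> < inverse (real (Suc n))" "\<And>n. r n \<notin> U"
        by metis
      have "dist (r n) \<rho> \<le> dist (inverse (real (Suc n))) 0" for n
        using r(3)[of n] by simp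
      then have "r \<longlonglongrightarrow> \<rho>"
        by (intro metric_tendsto_imp_tendsto[OF LIMSEQ_inverse_real_of_nat] always_eventually allI)
      then have "(r, \<rho>) \<in> C_I A" using r \<rho> by (simp add: C_I_iff)
      then have "\<forall>\<^sub>F i in sequentially. r i \<in> U"
        using U unfolding T_I_def openin_conv_topology by blast
      then show False using r(4) by simp
    qed
    then obtain e where e: "0 < e"
      "\<And>\<sigma>. \<sigma> \<in> state_space A \<Longrightarrow> mat_image \<sigma> = mat_image \<rho> \<Longrightarrow> dist \<sigma> \<rho> < e \<Longrightarrow> \<sigma> \<in> U"
      by blast
    obtain b where b: "b \<in> B" "\<rho> \<in> b" "b \<subseteq> ball \<rho> e"
      by (rule topological_basisE[OF B(2) open_ball, of \<rho> \<rho> e]) (use e(1) in auto)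
    show ?thesis
    proof (rule bexI)
      show "?F (b, mat_image \<rho>) \<in> D" unfolding D_def using b(1) \<rho> by blast
      show "\<rho> \<in> ?F (b, mat_image \<rho>) \<and> ?F (b, mat_image \<rho>) \<subseteq> U"
        using b \<rho> e(2) by (auto simp: dist_commute subset_eq)
    qed
  qed
  ultimately show ?thesis unfolding second_countable_def by blast
qed

lemma compact_space_T_norm:
  assumes "cstar_subalgebra A"
  shows "compact_space (T_norm A)"
  unfolding T_norm_def using compact_state_space[OF assms]
  by (simp add: compact_space_subtopology)

theorem corollary5p19:
  fixes A :: "(complex^'n^'n) set"
  assumes "cstar_subalgebra A"
  shows "(cmat.dim A > 1 \<longrightarrow>
            C_I A \<subset> C_rI A \<and>
            {U. openin (T_rI A) U} \<subset> {U. openin (T_I A) U} \<and>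
            \<not> compact_space (T_I A)) \<and>
         (commutative_algebra A \<longleftrightarrow> second_countable (T_I A)) \<and>
         (commutative_algebra A \<longleftrightarrow> second_countable (T_rI A)) \<and>
         (commutative_algebra A \<longleftrightarrow> C_rI A = C_norm A) \<and>
         (commutative_algebra A \<longleftrightarrow> T_rI A = T_norm A) \<and>
         (commutative_algebra A \<longleftrightarrow> compact_space (T_rI A))"
proof -
  \<comment> \<open>Equality of the convergences yields equality of the topologies, and the norm
    topology then passes compactness and second countability on to \<open>T_rI A\<close>. A
    noncommutative algebra violates the last two, which closes the circle for the four conditions on
    rI.\<close>
  have topology_eq: "T_rI A = T_norm A" if "C_rI A = C_norm A"
    unfolding T_rI_def T_norm_def that C_norm_def by (rule conv_topology_norm_conv)
  have compact: "compact_space (T_rI A)" if "T_rI A = T_norm A"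
    unfolding that by (rule compact_space_T_norm[OF assms])
  have countable: "second_countable (T_rI A)" if "T_rI A = T_norm A"
    unfolding that T_norm_def by (rule second_countable_top_of_set)
  show ?thesis
    using entropy_topologies_dim_gt_1[OF assms] noncommutative_entropy_topologies[OF assms] commutative_imp_second_countable_T_I[OF assms]
      commutative_imp_C_rI_eq_C_norm topology_eq compact countable
    by (intro conjI impI iffI) blast+
qed

end
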